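(* Let $M$ be an inertia operator of the form $$ M=\begin{pmatrix} \varepsilon(1-\partial^2)+\sum_{i=2}^{n_0} a_i\partial^{2i} & \sum_{i=0}^{n_1} (-1)^i b_i\partial^{i}\\ \sum_{i=0}^{n_1} b_i\partial^{i} & \gamma \end{pmatrix}, $$ where $a_i,b_i,\gamma,\varepsilon$ are real constants such that $M$ is strictly positive and invertible. Let $H_0\begin{pmatrix} m\\ p\end{pmatrix}=\frac12\left\langle \begin{pmatrix} m\\ p\end{pmatrix},M^{-1}\begin{pmatrix} m\\ p\end{pmatrix}\right\rangle$ and let $X=J_0\,\delta H_0$ be the corresponding Hamiltonian vector field on $\mathfrak g^*_{reg}$. Then $X$ is bi-Hamiltonian relative to a modified Lie-Poisson structure $$ J=\begin{pmatrix}2m_0\partial-c_1\partial^3 & p_0\partial+c_2\partial^2 \\ p_0\partial-c_2\partial^2 & 2c_3\partial \end{pmatrix} $$ with constant $m_0,p_0$ (that is, there exist real constants $m_0,p_0,c_1,c_2,c_3$ and a smooth functional $H_1:\mathfrak g^*_{reg}\to\mathbb R$ such that $X=J\,\delta H_1$) if and only if $M$ is of the form $$ M= \begin{pmatrix} \varepsilon(1-\partial^2) & \alpha-\beta\partial \\ \alpha+\beta\partial & \gamma \end{pmatrix} $$ for some real constants $\alpha,\beta,\gamma,\varepsilon$.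
   Context: $S^1$ is the circle with coordinate $x$ (of period $2\pi$) and $\partial=\frac{d}{dx}$. $\mathfrak g=\mathrm{Vect}(S^1)\ltimes C^\infty(S^1)$, where $f\in \mathrm{Vect}(S^1)$ acts on $C^\infty(S^1)$ by $L_f a=f a'$. The regular part $\mathfrak g^*_{reg}$ of the dual space is the set of pairs $\begin{pmatrix} m\\ p\end{pmatrix}$ with $m,p\in C^\infty(S^1)$, acting on $\mathfrak g$ through the $L^2$ pairing $$\left\langle \begin{pmatrix} m_1\\ p_1\end{pmatrix},\begin{pmatrix} m_2\\ p_2\end{pmatrix}\right\rangle=\int_{S^1}(m_1m_2+p_1p_2)\,dx.$$ For a smooth functional $H$ on $\mathfrak g^*_{reg}$, $\delta H$ denotes its gradient with respect to this $L^2$ pairing. The canonical Lie-Poisson structure on $\mathfrak g^*_{reg}$ is given by the skew-symmetric operator, depending on the point $\begin{pmatrix} m\\ p\end{pmatrix}$, $$J_0\left(\begin{pmatrix} m\\ p\end{pmatrix}\right)=\begin{pmatrix} m_x+2m\partial & p\partial\\ p_x+p\partial & 0\end{pmatrix},$$ where functions act by multiplication. A modified Lie-Poisson structure is a constant (independent of the point of $\mathfrak g^*_{reg}$) Poisson structure given by the skew-symmetric operator $$J=\begin{pmatrix}(m_0)_x+2m_0\partial-c_1\partial^3 & p_0\partial+c_2\partial^2 \\ (p_0)_x+p_0\partial-c_2\partial^2 & 2c_3\partial \end{pmatrix},$$ with $\begin{pmatrix} m_0\\ p_0\end{pmatrix}\in\mathfrak g^*_{reg}$ and $c_1,c_2,c_3\in\mathbb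 R$. It comes from a 2-cocycle on $\mathfrak g$ and is compatible with $J_0$. When $m_0,p_0$ are constant functions the terms $(m_0)_x,(p_0)_x$ vanish. The operator $M$ acts on pairs of smooth functions on $S^1$ and is symmetric with respect to $\langle\cdot,\cdot\rangle$. Strictly positive means $\langle w,Mw\rangle>0$ for all nonzero $w$. *)

theory Defs
  imports "HOL-Analysis.Analysis"
begin

text \<open>
  Functions on the circle are \<open>2\<pi>\<close>-periodic functions on the real line. Pairs of smooth functions
  serve both as points \<open>(m, p)\<close> of the regular dual and as elements \<open>(u, \<rho>)\<close> of the Lie algebra
  \<open>Vect(S\<^sup>1) \<ltimes> C\<^sup>\<infinity>(S\<^sup>1)\<close>; the two spaces are identified by the \<open>L\<^sup>2\<close> pairing.
\<close>

type_synonym fpair = "(real \<Rightarrow> real) \<times> (real \<Rightarrow> real)"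

definition circle_smooth :: "(real \<Rightarrow> real) set" where
  "circle_smooth =
     {f. (\<forall>x. f (x + 2 * pi) = f x) \<and> (\<forall>k x. (deriv ^^ k) f field_differentiable (at x))}"

definition gdual :: "fpair set" where
  "gdual = circle_smooth \<times> circle_smooth"

definition pairing :: "fpair \<Rightarrow> fpair \<Rightarrow> real" where
  "pairing \<mu> \<nu> = integral {0..2 * pi} (\<lambda>x. fst \<mu> x * fst \<nu> x + snd \<mu> x * snd \<nu> x)"

definition translate :: "fpair \<Rightarrow> real \<Rightarrow> fpair \<Rightarrow> fpair" where
  "translate \<mu> t \<nu> = ((\<lambda>x. fst \<mu> x + t * fst \<nu> x), (\<lambda>x. snd \<mu> x + t * snd \<nu> x))"

text \<open>Convergence in the Frechet topology of \<open>C\<^sup>\<infinity>(S\<^sup>1) \<times> C\<^sup>\<infinity>(S\<^sup>1)\<close>.\<close>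

definition Cinf_tendsto :: "(nat \<Rightarrow> fpair) \<Rightarrow> fpair \<Rightarrow> bool" where
  "Cinf_tendsto \<mu>s \<mu> \<longleftrightarrow>
     (\<forall>k. uniform_limit UNIV (\<lambda>n. (deriv ^^ k) (fst (\<mu>s n))) ((deriv ^^ k) (fst \<mu>)) sequentially \<and>
          uniform_limit UNIV (\<lambda>n. (deriv ^^ k) (snd (\<mu>s n))) ((deriv ^^ k) (snd \<mu>)) sequentially)"

text \<open>
  Smoothness on a Frechet space, in the sense of Michal-Bastiani and Hamilton: the iterated
  directional derivatives \<open>D [\<nu>\<^sub>1, \<dots>, \<nu>\<^sub>n] \<mu>\<close> of all orders exist and are jointly continuous in
  the point and the directions. Sequential continuity suffices, the topology being metrizable.
  Only the values of \<open>H\<close> on \<open>gdual\<close> matter.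
\<close>

definition smooth_functional :: "(fpair \<Rightarrow> real) \<Rightarrow> bool" where
  "smooth_functional H \<longleftrightarrow>
     (\<exists>D :: fpair list \<Rightarrow> fpair \<Rightarrow> real.
        (\<forall>\<mu>\<in>gdual. D [] \<mu> = H \<mu>) \<and>
        (\<forall>\<nu>s\<in>lists gdual. \<forall>\<nu>\<in>gdual. \<forall>\<mu>\<in>gdual.
           ((\<lambda>t. D \<nu>s (translate \<mu> t \<nu>)) has_real_derivative D (\<nu>s @ [\<nu>]) \<mu>) (at 0)) \<and>
        (\<forall>\<nu>ss \<nu>s \<mu>s \<mu>.
           \<nu>s \<in> lists gdual \<and> \<mu> \<in> gdual \<and>
           (\<forall>n. \<nu>ss n \<in> lists gdual \<and> length (\<nu>ss n) = length \<nu>s \<and> \<mu>s n \<in> gdual) \<and>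
           Cinf_tendsto \<mu>s \<mu> \<and> (\<forall>i<length \<nu>s. Cinf_tendsto (\<lambda>n. \<nu>ss n ! i) (\<nu>s ! i)) \<longrightarrow>
           (\<lambda>n. D (\<nu>ss n) (\<mu>s n)) \<longlonglongrightarrow> D \<nu>s \<mu>))"

definition has_L2_gradient :: "(fpair \<Rightarrow> real) \<Rightarrow> fpair \<Rightarrow> fpair \<Rightarrow> bool" where
  "has_L2_gradient H \<mu> g \<longleftrightarrow>
     g \<in> gdual \<and>
     (\<forall>\<nu>\<in>gdual. ((\<lambda>t. H (translate \<mu> t \<nu>)) has_real_derivative pairing g \<nu>) (at 0))"

text \<open>Gradients are unique, but a smooth functional need not have one (its differential may be a
  distribution not represented by a smooth pair), so existence is a separate condition.\<close>

definition L2_differentiable :: "(fpair \<Rightarrow> real) \<Rightarrow> bool" where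
  "L2_differentiable H \<longleftrightarrow> (\<forall>\<mu>\<in>gdual. \<exists>g. has_L2_gradient H \<mu> g)"

definition L2_gradient :: "(fpair \<Rightarrow> real) \<Rightarrow> fpair \<Rightarrow> fpair" where
  "L2_gradient H \<mu> = (THE g. has_L2_gradient H \<mu> g)"

definition lie_poisson :: "fpair \<Rightarrow> fpair \<Rightarrow> fpair" where
  "lie_poisson = (\<lambda>(m, p) (f, g).
     ((\<lambda>x. deriv m x * f x + 2 * m x * deriv f x + p x * deriv g x),
      (\<lambda>x. deriv p x * f x + p x * deriv f x)))"

definition modified_lie_poisson :: "real \<Rightarrow> real \<Rightarrow> real \<Rightarrow> real \<Rightarrow> real \<Rightarrow> fpair \<Rightarrow> fpair" where
  "modified_lie_poisson m\<^sub>0 p\<^sub>0 c\<^sub>1 c\<^sub>2 c\<^sub>3 = (\<lambda>(f, g).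
     ((\<lambda>x. 2 * m\<^sub>0 * deriv f x - c\<^sub>1 * (deriv ^^ 3) f x + p\<^sub>0 * deriv g x + c\<^sub>2 * (deriv ^^ 2) g x),
      (\<lambda>x. p\<^sub>0 * deriv f x - c\<^sub>2 * (deriv ^^ 2) f x + 2 * c\<^sub>3 * deriv g x)))"

definition inertia_operator ::
  "nat \<Rightarrow> nat \<Rightarrow> (nat \<Rightarrow> real) \<Rightarrow> (nat \<Rightarrow> real) \<Rightarrow> real \<Rightarrow> real \<Rightarrow> fpair \<Rightarrow> fpair" where
  "inertia_operator n\<^sub>0 n\<^sub>1 a b \<gamma> \<epsilon> = (\<lambda>(u, \<rho>).
     ((\<lambda>x. \<epsilon> * (u x - (deriv ^^ 2) u x) + (\<Sum>i=2..n\<^sub>0. a i * (deriv ^^ (2 * i)) u x)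
           + (\<Sum>i=0..n\<^sub>1. (-1) ^ i * b i * (deriv ^^ i) \<rho> x)),
      (\<lambda>x. (\<Sum>i=0..n\<^sub>1. b i * (deriv ^^ i) u x) + \<gamma> * \<rho> x)))"

definition special_inertia_operator :: "real \<Rightarrow> real \<Rightarrow> real \<Rightarrow> real \<Rightarrow> fpair \<Rightarrow> fpair" where
  "special_inertia_operator \<alpha> \<beta> \<gamma> \<epsilon> = (\<lambda>(u, \<rho>).
     ((\<lambda>x. \<epsilon> * (u x - (deriv ^^ 2) u x) + (\<alpha> * \<rho> x - \<beta> * deriv \<rho> x)),
      (\<lambda>x. (\<alpha> * u x + \<beta> * deriv u x) + \<gamma> * \<rho> x)))"

definition strictly_positive :: "(fpair \<Rightarrow> fpair) \<Rightarrow> bool" where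
  "strictly_positive M \<longleftrightarrow> (\<forall>w\<in>gdual. w \<noteq> ((\<lambda>x. 0), (\<lambda>x. 0)) \<longrightarrow> pairing w (M w) > 0)"

definition kinetic_energy :: "(fpair \<Rightarrow> fpair) \<Rightarrow> fpair \<Rightarrow> real" where
  "kinetic_energy M \<mu> = 1 / 2 * pairing \<mu> (inv_into gdual M \<mu>)"

definition euler_field :: "(fpair \<Rightarrow> fpair) \<Rightarrow> fpair \<Rightarrow> fpair" where
  "euler_field M \<mu> = lie_poisson \<mu> (L2_gradient (kinetic_energy M) \<mu>)"

end

theory Submission
  imports Defs
begin

text \<open>
  Write \<open>w = (u, \<rho>)\<close> and \<open>\<mu> = M w\<close>. The gradient of the kinetic energy at \<open>\<mu>\<close> is \<open>w\<close>, so the Euler field is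
  \<open>X \<mu> = lie_poisson \<mu> w\<close>, a quadratic expression. Both implications are governed by the recursion
  operator \<open>D = inv M \<circ> J\<close>.

  Necessity. If \<open>X = J (grad H)\<close>, then the derivative of \<open>H\<close> in each direction \<open>J v\<close> is
  \<open>-\<langle>X, v\<rangle>\<close>. Comparing the mixed coefficients of \<open>H\<close> on planes spanned by two such directions gives a symmetry of
  the linearization of \<open>X\<close> (\<open>linearized_field_symmetric\<close>). Since \<open>lie_poisson\<close> is the coadjoint action and
  \<open>J\<close> is a \<open>2\<close>-cocycle, this symmetry says that \<open>D\<close> is a derivation of the Lie algebra
  (\<open>recursion_operator_derivation\<close>). Brackets with the elements \<open>(0, \<rho>)\<close> then pin it down:
  \<open>D (0, \<rho>) = (0, c \<rho>')\<close> and \<open>D (u, 0) = (c u', S u)\<close> with \<open>c = 2 c\<^sub>3 / \<gamma>\<close>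
  (\<open>derivation_on_second_factor\<close>, \<open>derivation_on_first_factor\<close>). If \<open>c = 0\<close>, then \<open>M D = J\<close> forces
  \<open>J = 0\<close> and \<open>X = 0\<close>, which is false at \<open>M (0, sin)\<close> because \<open>\<gamma> > 0\<close>. If \<open>c \<noteq> 0\<close>, the entries of \<open>M D = J\<close> bound the
  orders of the entries of \<open>M\<close>, and comparison of coefficients shows that \<open>M\<close> is special
  (\<open>bihamiltonian_imp_special\<close>).

  Sufficiency. For special \<open>M\<close> the operator \<open>\<partial> M\<close> is itself a modified Lie-Poisson operator \<open>J\<close>, and the Euler field
  is a total derivative, \<open>X (M w) = \<partial> (N w)\<close>, where moreover \<open>N\<close> is the gradient of a cubic energy
  \<open>E\<close>. Hence \<open>H = E \<circ> inv M\<close> has the gradient \<open>inv M (N w)\<close>, which \<open>J\<close> maps to \<open>X\<close>. The analytic point is the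
  smoothness of \<open>H\<close>, that is the continuity of \<open>inv M\<close> in the \<open>C\<^sup>\<infinity>\<close> topology
  (\<open>special_inverse_continuous\<close>). Eliminating \<open>\<rho>\<close> leaves an equation \<open>a u - b u'' = h\<close> in which positivity
  of \<open>M\<close> gives \<open>a > 0\<close> and \<open>b \<ge> 0\<close>, so that the maximum principle bounds all derivatives of \<open>u\<close>.
\<close>

section \<open>Smooth functions on the circle\<close>

lemma circle_smooth_periodic: "f \<in> circle_smooth \<Longrightarrow> f (x + 2 * pi) = f x"
  by (simp add: circle_smooth_def)

lemma circle_smooth_DERIV:
  assumes "f \<in> circle_smooth"
  shows "(f has_real_derivative deriv f x) (at x)"
proof -
  have "(deriv ^^ 0) f field_differentiable (at x)"
    using assms unfolding circle_smooth_def by blast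
  then show ?thesis
    by (simp add: DERIV_deriv_iff_field_differentiable)
qed

text \<open>
  Smooth periodic functions form the largest class of differentiable periodic functions that is
  closed under differentiation. Membership of a given function then only needs a class around it
  with this closure property, and no formula for its higher derivatives.
\<close>

lemma circle_smooth_coinduct:
  assumes f: "f \<in> F"
    and step: "\<And>g. g \<in> F \<Longrightarrow>
      (\<forall>x. g (x + 2 * pi) = g x) \<and> (\<exists>g'\<in>F. \<forall>x. (g has_real_derivative g' x) (at x))"
  shows "f \<in> circle_smooth"
proof -
  have closed: "deriv g \<in> F" if g: "g \<in> F" for g
  proof -
    obtain g' where g': "g' \<in> F" "\<forall>x. (g has_real_derivative g' x) (at x)"
      using step[OF g] by blast
    then have "deriv g = g'"
      by (auto intro: DERIV_imp_deriv)
    with g' show ?thesis by simp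
  qed
  have iterate: "(deriv ^^ k) f \<in> F" for k
    by (induction k) (simp_all add: f closed)
  have "(deriv ^^ k) f field_differentiable (at x)" for k x
    using step[OF iterate[of k]] unfolding field_differentiable_def by blast
  then show ?thesis
    using step[OF f] unfolding circle_smooth_def by blast
qed

lemma circle_smooth_deriv:
  assumes "f \<in> circle_smooth"
  shows "deriv f \<in> circle_smooth"
proof -
  have "deriv f (x + 2 * pi) = deriv f x" for x
  proof -
    have "((\<lambda>y. f (y + 2 * pi)) has_real_derivative deriv f (x + 2 * pi)) (at x)"
      using circle_smooth_DERIV[OF assms, of "x + 2 * pi"] by (simp add: DERIV_shift)
    then have "(f has_real_derivative deriv f (x + 2 * pi)) (at x)"
      by (simp add: circle_smooth_periodic[OF assms])
    from DERIV_unique[OF this circle_smooth_DERIV[OF assms]] show ?thesis .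
  qed
  moreover have "(deriv ^^ k) (deriv f) field_differentiable (at x)" for k x
  proof -
    have "(deriv ^^ Suc k) f field_differentiable (at x)"
      using assms unfolding circle_smooth_def by blast
    then show ?thesis by (simp add: funpow_swap1)
  qed
  ultimately show ?thesis unfolding circle_smooth_def by blast
qed

lemma circle_smooth_iterated_deriv: "f \<in> circle_smooth \<Longrightarrow> (deriv ^^ k) f \<in> circle_smooth"
  by (induction k) (simp_all add: circle_smooth_deriv)

text \<open>
  The algebra generated by the smooth functions is closed under differentiation by the Leibniz
  rule, so by coinduction it contains nothing new. This replaces the higher Leibniz formula in the
  proof that products are smooth.
\<close>

inductive_set smooth_algebra :: "(real \<Rightarrow> real) set" where
  smooth_algebra_base: "f \<in> circle_smooth \<Longrightarrow> f \<in> smooth_algebra"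
| smooth_algebra_add: "f \<in> smooth_algebra \<Longrightarrow> g \<in> smooth_algebra \<Longrightarrow> (\<lambda>x. f x + g x) \<in> smooth_algebra"
| smooth_algebra_mult: "f \<in> smooth_algebra \<Longrightarrow> g \<in> smooth_algebra \<Longrightarrow> (\<lambda>x. f x * g x) \<in> smooth_algebra"

lemma smooth_algebra_deriv_closed:
  assumes "h \<in> smooth_algebra"
  shows "(\<forall>x. h (x + 2 * pi) = h x) \<and>
    (\<exists>h'\<in>smooth_algebra. \<forall>x. (h has_real_derivative h' x) (at x))"
  using assms
proof (induction h rule: smooth_algebra.induct)
  case (smooth_algebra_base f)
  then show ?case
    by (meson circle_smooth_DERIV circle_smooth_deriv circle_smooth_periodic
        smooth_algebra.smooth_algebra_base)
next
  case (smooth_algebra_add f g)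
  then obtain f' g' where f': "f' \<in> smooth_algebra" "\<And>x. (f has_real_derivative f' x) (at x)"
    and g': "g' \<in> smooth_algebra" "\<And>x. (g has_real_derivative g' x) (at x)"
    by blast
  have "((\<lambda>x. f x + g x) has_real_derivative f' x + g' x) (at x)" for x
    using f' g' by (auto intro: DERIV_add)
  moreover have "(\<lambda>x. f' x + g' x) \<in> smooth_algebra"
    using f' g' by (intro smooth_algebra.smooth_algebra_add)
  moreover have "\<forall>x. f (x + 2 * pi) + g (x + 2 * pi) = f x + g x"
    using smooth_algebra_add.IH by simp
  ultimately show ?case by (intro conjI bexI[of _ "\<lambda>x. f' x + g' x"]) auto
next
  case (smooth_algebra_mult f g)
  then obtain f' g' where f': "f' \<in> smooth_algebra" "\<And>x. (f has_real_derivative f' x) (at x)"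
    and g': "g' \<in> smooth_algebra" "\<And>x. (g has_real_derivative g' x) (at x)"
    by blast
  have "((\<lambda>x. f x * g x) has_real_derivative f' x * g x + g' x * f x) (at x)" for x
    using f' g' by (intro DERIV_mult) auto
  moreover have "(\<lambda>x. f' x * g x + g' x * f x) \<in> smooth_algebra"
    using f' g' smooth_algebra_mult.hyps
    by (intro smooth_algebra.smooth_algebra_add smooth_algebra.smooth_algebra_mult)
  moreover have "\<forall>x. f (x + 2 * pi) * g (x + 2 * pi) = f x * g x"
    using smooth_algebra_mult.IH by simp
  ultimately show ?case by (intro conjI bexI[of _ "\<lambda>x. f' x * g x + g' x * f x"]) auto
qed

lemma smooth_algebra_eq: "smooth_algebra = circle_smooth"
  using circle_smooth_coinduct[OF _ smooth_algebra_deriv_closed] smooth_algebra_base by blast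

lemma circle_smooth_add:
  "f \<in> circle_smooth \<Longrightarrow> g \<in> circle_smooth \<Longrightarrow> (\<lambda>x. f x + g x) \<in> circle_smooth"
  using smooth_algebra_add unfolding smooth_algebra_eq .

lemma circle_smooth_mult:
  "f \<in> circle_smooth \<Longrightarrow> g \<in> circle_smooth \<Longrightarrow> (\<lambda>x. f x * g x) \<in> circle_smooth"
  using smooth_algebra_mult unfolding smooth_algebra_eq .

lemma circle_smooth_const: "(\<lambda>x. c) \<in> circle_smooth"
proof (rule circle_smooth_coinduct)
  show "(\<lambda>x. c) \<in> range (\<lambda>c x. c)" by blast
next
  fix g :: "real \<Rightarrow> real" assume "g \<in> range (\<lambda>c x. c)"
  then obtain d where "g = (\<lambda>x. d)" by blast
  moreover have "(\<lambda>x::real. 0) \<in> range (\<lambda>(c::real) (x::real). c)" by blast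
  ultimately show "(\<forall>x. g (x + 2 * pi) = g x) \<and>
      (\<exists>g'\<in>range (\<lambda>c x. c). \<forall>x. (g has_real_derivative g' x) (at x))"
    by (intro conjI bexI[of _ "\<lambda>x. 0"]) auto
qed

lemma circle_smooth_uminus: "f \<in> circle_smooth \<Longrightarrow> (\<lambda>x. - f x) \<in> circle_smooth"
  using circle_smooth_mult[OF circle_smooth_const[of "- 1"], of f] by simp

lemma circle_smooth_diff:
  "f \<in> circle_smooth \<Longrightarrow> g \<in> circle_smooth \<Longrightarrow> (\<lambda>x. f x - g x) \<in> circle_smooth"
  using circle_smooth_add[OF _ circle_smooth_uminus, of f g] by simp

lemma circle_smooth_divide_const: "f \<in> circle_smooth \<Longrightarrow> (\<lambda>x. f x / c) \<in> circle_smooth"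
  using circle_smooth_mult[OF _ circle_smooth_const[of "inverse c"], of f]
  by (simp add: divide_inverse)

lemma circle_smooth_power2: "f \<in> circle_smooth \<Longrightarrow> (\<lambda>x. (f x)\<^sup>2) \<in> circle_smooth"
  using circle_smooth_mult[of f f] by (simp add: power2_eq_square)

lemma circle_smooth_sum:
  assumes "\<And>i. i \<in> I \<Longrightarrow> f i \<in> circle_smooth"
  shows "(\<lambda>x. \<Sum>i\<in>I. f i x) \<in> circle_smooth"
  using assms
proof (induction I rule: infinite_finite_induct)
  case (insert i I)
  then show ?case
    using circle_smooth_add[of "f i" "\<lambda>x. \<Sum>i\<in>I. f i x"] by simp
qed (simp_all add: circle_smooth_const)

lemmas circle_smooth_intros =
  circle_smooth_add circle_smooth_mult circle_smooth_const circle_smooth_uminus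
  circle_smooth_diff circle_smooth_divide_const circle_smooth_power2 circle_smooth_sum
  circle_smooth_deriv circle_smooth_iterated_deriv

lemma DERIV_sin_wave:
  "((\<lambda>y. a * sin (real k * y + \<theta>)) has_real_derivative
     real k * a * sin (real k * x + (\<theta> + pi / 2))) (at x)"
  by (rule derivative_eq_intros refl | simp)+ (simp add: sin_add cos_add algebra_simps)

text \<open>
  The phase is kept free because differentiation acts on these waves by a factor and a shift of the
  phase by a quarter turn; so one family covers sines and cosines alike.
\<close>

lemma sin_wave_circle_smooth: "(\<lambda>x. a * sin (real k * x + \<theta>)) \<in> circle_smooth"
proof (rule circle_smooth_coinduct)
  let ?F = "{\<lambda>x. a * sin (real k * x + \<theta>) |a \<theta>. True}"
  show "(\<lambda>x. a * sin (real k * x + \<theta>)) \<in> ?F" by blast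
  fix g assume "g \<in> ?F"
  then obtain a \<theta> where g: "g = (\<lambda>x. a * sin (real k * x + \<theta>))" by blast
  have "sin (real k * (x + 2 * pi) + \<theta>) = sin (real k * x + \<theta>)" for x
  proof -
    have "sin (real k * (x + 2 * pi) + \<theta>) = sin ((real k * x + \<theta>) + real k * (2 * pi))"
      by (simp add: algebra_simps)
    also have "\<dots> = sin (real k * x + \<theta>)"
      using sin.plus_of_nat[of "real k * x + \<theta>" k] by simp
    finally show ?thesis .
  qed
  moreover have "(\<lambda>x. real k * a * sin (real k * x + (\<theta> + pi / 2))) \<in> ?F"
    by blast
  ultimately show "(\<forall>x. g (x + 2 * pi) = g x) \<and> (\<exists>g'\<in>?F. \<forall>x. (g has_real_derivative g' x) (at x))"
    unfolding g using DERIV_sin_wave[of a k \<theta>] by (intro conjI bexI) auto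
qed

lemma iterated_deriv_sin_wave:
  "(deriv ^^ n) (\<lambda>x. sin (real k * x + \<theta>)) =
     (\<lambda>x. real k ^ n * sin (real k * x + (\<theta> + real n * (pi / 2))))"
proof (induction n)
  case (Suc n)
  have "(deriv ^^ Suc n) (\<lambda>x. sin (real k * x + \<theta>)) =
      deriv (\<lambda>x. real k ^ n * sin (real k * x + (\<theta> + real n * (pi / 2))))"
    by (simp add: Suc)
  also have "\<dots> = (\<lambda>x. real k * real k ^ n * sin (real k * x + (\<theta> + real n * (pi / 2) + pi / 2)))"
    by (rule ext, rule DERIV_imp_deriv, rule DERIV_sin_wave)
  also have "\<dots> = (\<lambda>x. real k ^ Suc n * sin (real k * x + (\<theta> + real (Suc n) * (pi / 2))))"
    by (simp add: add_divide_distrib algebra_simps)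
  finally show ?case .
qed simp

lemma sin_circle_smooth: "sin \<in> circle_smooth"
  using sin_wave_circle_smooth[of 1 1 0] by simp

lemma deriv_sin_fun: "deriv sin = (cos :: real \<Rightarrow> real)"
  by (auto intro: DERIV_imp_deriv DERIV_sin)

lemma cos_circle_smooth: "cos \<in> circle_smooth"
  using circle_smooth_deriv[OF sin_circle_smooth] by (simp add: deriv_sin_fun)

lemma deriv_cos_fun: "deriv cos = (\<lambda>x :: real. - sin x)"
  by (auto intro: DERIV_imp_deriv DERIV_cos)

lemma circle_smooth_deriv_lin:
  assumes "f \<in> circle_smooth" "g \<in> circle_smooth"
  shows "deriv (\<lambda>x. f x + t * g x) = (\<lambda>x. deriv f x + t * deriv g x)"
proof
  fix x
  show "deriv (\<lambda>x. f x + t * g x) x = deriv f x + t * deriv g x"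
    by (rule DERIV_imp_deriv)
       (auto intro!: derivative_eq_intros circle_smooth_DERIV[OF assms(1)] circle_smooth_DERIV[OF assms(2)])
qed

lemma iterated_deriv_lin:
  assumes "f \<in> circle_smooth" "g \<in> circle_smooth"
  shows "(deriv ^^ k) (\<lambda>x. f x + t * g x) = (\<lambda>x. (deriv ^^ k) f x + t * (deriv ^^ k) g x)"
  by (induction k)
     (simp_all add: circle_smooth_deriv_lin circle_smooth_iterated_deriv assms)

lemma deriv_pow_2: "(deriv ^^ 2) f = deriv (deriv f)"
  and deriv_pow_3: "(deriv ^^ 3) f = deriv (deriv (deriv f))"
  by (simp_all add: numeral_2_eq_2 numeral_3_eq_3)

lemma iterated_deriv_zero: "(deriv ^^ k) (\<lambda>x::real. 0 :: real) = (\<lambda>x. 0)"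
  by (induction k) auto

lemma circle_smooth_continuous_on: "f \<in> circle_smooth \<Longrightarrow> continuous_on S f"
  by (meson DERIV_continuous_on circle_smooth_DERIV has_field_derivative_at_within)

lemma circle_smooth_integrable: "f \<in> circle_smooth \<Longrightarrow> f integrable_on {0..2 * pi}"
  by (intro integrable_continuous_real circle_smooth_continuous_on)

text \<open>
  Integration by parts on the circle, in the form in which it is used: two integrands that differ
  by the derivative of a periodic function have the same integral.
\<close>

lemma integral_eq_of_total_derivative:
  assumes f: "f \<in> circle_smooth" and g: "g \<in> circle_smooth" and F: "F \<in> circle_smooth"
    and der: "\<And>x. (F has_real_derivative f x - g x) (at x)"
  shows "integral {0..2 * pi} f = integral {0..2 * pi} g"
proof -
  have "((\<lambda>x. f x - g x) has_integral F (2 * pi) - F 0) {0..2 * pi}"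
    using der
    by (intro fundamental_theorem_of_calculus)
       (auto simp: has_real_derivative_iff_has_vector_derivative[symmetric]
             intro: has_field_derivative_at_within)
  moreover have "F (2 * pi) = F 0"
    using circle_smooth_periodic[OF F, of 0] by simp
  ultimately have "integral {0..2 * pi} (\<lambda>x. f x - g x) = 0"
    by (simp add: integral_unique)
  then show ?thesis
    by (simp add: Henstock_Kurzweil_Integration.integral_diff circle_smooth_integrable f g)
qed

lemma periodic_reduce:
  fixes f :: "real \<Rightarrow> 'a"
  assumes "\<And>x. f (x + 2 * pi) = f x"
  obtains y where "y \<in> {0..2 * pi}" "f x = f y"
proof -
  interpret periodic_fun_simple f "2 * pi"
    using assms by unfold_locales
  define n where "n = \<lfloor>x / (2 * pi)\<rfloor>"
  have "of_int n \<le> x / (2 * pi)" "x / (2 * pi) < of_int n + 1"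
    unfolding n_def by linarith+
  then have "x - of_int n * (2 * pi) \<in> {0..2 * pi}"
    by (simp add: field_simps)
  moreover have "f x = f (x - of_int n * (2 * pi))"
    by (simp add: minus_of_int)
  ultimately show thesis by (rule that[of "x - of_int n * (2 * pi)"])
qed

lemma circle_smooth_attains_max:
  assumes "f \<in> circle_smooth"
  obtains x where "\<And>y. f y \<le> f x"
proof -
  obtain x where x: "\<And>y. y \<in> {0..2 * pi} \<Longrightarrow> f y \<le> f x"
    using continuous_attains_sup[of "{0..2 * pi}" f] circle_smooth_continuous_on[OF assms]
    by (metis atLeastatMost_empty_iff compact_Icc pi_ge_zero mult_nonneg_nonneg zero_le_numeral)
  have "f y \<le> f x" for y
    using periodic_reduce[of f y, OF circle_smooth_periodic[OF assms]] x by metis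
  then show thesis by (rule that)
qed

lemma circle_smooth_bounded:
  assumes "f \<in> circle_smooth"
  shows "bounded (range f)"
proof -
  obtain x where x: "\<And>y. f y \<le> f x"
    using circle_smooth_attains_max[OF assms] by blast
  obtain z where z: "\<And>y. - f y \<le> - f z"
    using circle_smooth_attains_max[OF circle_smooth_uminus[OF assms]] by blast
  have "norm (f y) \<le> max \<bar>f x\<bar> \<bar>f z\<bar>" for y
    using x[of y] z[of y] by (simp add: max_def) linarith
  then show ?thesis
    by (auto simp: bounded_iff)
qed

lemma circle_smooth_nonneg_integral_eq_0:
  assumes f: "f \<in> circle_smooth" and nonneg: "\<And>x. 0 \<le> f x"
    and int: "integral {0..2 * pi} f = 0"
  shows "f x = 0"
proof -
  have *: "f y = 0" if "y \<in> {0..2 * pi}" for y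
    using integral_eq_0_iff[of 0 "2 * pi" f] circle_smooth_continuous_on[OF f] nonneg int that
    by auto
  show ?thesis
    using periodic_reduce[of f x, OF circle_smooth_periodic[OF f]] * by metis
qed

section \<open>The pairing and linear maps on pairs of smooth functions\<close>

lemma gdual_cases:
  assumes "w \<in> gdual"
  obtains u \<rho> where "w = (u, \<rho>)" "u \<in> circle_smooth" "\<rho> \<in> circle_smooth"
  using assms by (auto simp: gdual_def)

lemma mem_gdual [simp]: "(u, \<rho>) \<in> gdual \<longleftrightarrow> u \<in> circle_smooth \<and> \<rho> \<in> circle_smooth"
  by (simp add: gdual_def)

lemma gdual_fst: "w \<in> gdual \<Longrightarrow> fst w \<in> circle_smooth"
  and gdual_snd: "w \<in> gdual \<Longrightarrow> snd w \<in> circle_smooth"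
  by (auto simp: gdual_def)

lemma translate_gdual: "\<mu> \<in> gdual \<Longrightarrow> \<nu> \<in> gdual \<Longrightarrow> translate \<mu> t \<nu> \<in> gdual"
  by (auto simp: gdual_def translate_def intro!: circle_smooth_intros)

lemma pairing_commute: "pairing \<mu> \<nu> = pairing \<nu> \<mu>"
  by (simp add: pairing_def mult.commute)

lemma pairing_translate:
  assumes "\<mu> \<in> gdual" "\<nu> \<in> gdual" "\<phi> \<in> gdual"
  shows "pairing (translate \<mu> t \<nu>) \<phi> = pairing \<mu> \<phi> + t * pairing \<nu> \<phi>"
proof -
  let ?f = "\<lambda>\<mu> x. fst \<mu> x * fst \<phi> x + snd \<mu> x * snd \<phi> x"
  have int: "?f \<mu> integrable_on {0..2 * pi}" if "\<mu> \<in> gdual" for \<mu>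
    using that assms(3) by (intro circle_smooth_integrable circle_smooth_intros gdual_fst gdual_snd)
  have "pairing (translate \<mu> t \<nu>) \<phi> = integral {0..2 * pi} (\<lambda>x. ?f \<mu> x + t * ?f \<nu> x)"
    by (simp add: pairing_def translate_def algebra_simps)
  also have "\<dots> = integral {0..2 * pi} (?f \<mu>) + integral {0..2 * pi} (\<lambda>x. t * ?f \<nu> x)"
    by (intro Henstock_Kurzweil_Integration.integral_add int assms integrable_on_mult_right)
  finally show ?thesis
    by (simp add: pairing_def)
qed

lemma pairing_translate_right:
  assumes "\<mu> \<in> gdual" "\<nu> \<in> gdual" "\<phi> \<in> gdual"
  shows "pairing \<phi> (translate \<mu> t \<nu>) = pairing \<phi> \<mu> + t * pairing \<phi> \<nu>"
  using pairing_translate[OF assms] by (simp add: pairing_commute)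

lemma pairing_nondegenerate:
  assumes "\<mu> \<in> gdual" "\<nu> \<in> gdual" and eq: "\<And>\<phi>. \<phi> \<in> gdual \<Longrightarrow> pairing \<mu> \<phi> = pairing \<nu> \<phi>"
  shows "\<mu> = \<nu>"
proof -
  define d where "d = translate \<mu> (- 1) \<nu>"
  have d: "d \<in> gdual"
    unfolding d_def by (intro translate_gdual assms)
  let ?q = "\<lambda>x. (fst d x)\<^sup>2 + (snd d x)\<^sup>2"
  have "pairing d d = 0"
    using eq[OF d] pairing_translate[OF assms(1,2) d, of "- 1"] by (simp add: d_def)
  then have "integral {0..2 * pi} ?q = 0"
    by (simp add: pairing_def power2_eq_square)
  moreover have "?q \<in> circle_smooth"
    using d by (intro circle_smooth_intros gdual_fst gdual_snd)
  ultimately have "?q x = 0" for x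
    using circle_smooth_nonneg_integral_eq_0[of ?q x] by simp
  then have "fst d x = 0" "snd d x = 0" for x
    by (simp_all add: sum_power2_eq_zero_iff)
  then show ?thesis
    by (auto simp: d_def translate_def prod_eq_iff)
qed

lemma L2_gradient_eqI:
  assumes "has_L2_gradient H \<mu> g"
  shows "L2_gradient H \<mu> = g"
  unfolding L2_gradient_def
proof (rule the_equality)
  fix g' assume g': "has_L2_gradient H \<mu> g'"
  show "g' = g"
    using g' assms by (intro pairing_nondegenerate) (auto simp: has_L2_gradient_def intro: DERIV_unique)
qed (rule assms)

text \<open>
  The single combination \<open>\<mu> + t \<nu>\<close> encodes both additivity and homogeneity: \<open>t = -1\<close>, \<open>\<nu> = \<mu>\<close>
  shows that the zero pair goes to itself.
\<close>

definition gdual_linear :: "(fpair \<Rightarrow> fpair) \<Rightarrow> bool" where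
  "gdual_linear L \<longleftrightarrow> (\<forall>\<mu>\<in>gdual. L \<mu> \<in> gdual \<and>
     (\<forall>\<nu>\<in>gdual. \<forall>t. L (translate \<mu> t \<nu>) = translate (L \<mu>) t (L \<nu>)))"

lemma gdual_linear_mem: "gdual_linear L \<Longrightarrow> \<mu> \<in> gdual \<Longrightarrow> L \<mu> \<in> gdual"
  by (simp add: gdual_linear_def)

lemma gdual_linear_translate:
  "gdual_linear L \<Longrightarrow> \<mu> \<in> gdual \<Longrightarrow> \<nu> \<in> gdual \<Longrightarrow> L (translate \<mu> t \<nu>) = translate (L \<mu>) t (L \<nu>)"
  by (simp add: gdual_linear_def)

lemma gdual_linear_compose: "gdual_linear K \<Longrightarrow> gdual_linear L \<Longrightarrow> gdual_linear (\<lambda>\<mu>. K (L \<mu>))"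
  by (simp add: gdual_linear_def)

lemma gdual_linear_inv:
  assumes L: "gdual_linear L" and bij: "bij_betw L gdual gdual"
  shows "gdual_linear (inv_into gdual L)"
  unfolding gdual_linear_def
proof (intro ballI conjI allI)
  fix \<mu> \<nu> t assume mem: "\<mu> \<in> gdual" "\<nu> \<in> gdual"
  let ?K = "inv_into gdual L"
  have K: "?K \<mu> \<in> gdual \<and> L (?K \<mu>) = \<mu>" if "\<mu> \<in> gdual" for \<mu>
    using bij that by (metis bij_betw_def bij_betw_inv_into_right inv_into_into)
  show "?K \<mu> \<in> gdual"
    using K mem by blast
  have "L (translate (?K \<mu>) t (?K \<nu>)) = translate \<mu> t \<nu>"
    using K mem gdual_linear_translate[OF L] by simp
  then show "?K (translate \<mu> t \<nu>) = translate (?K \<mu>) t (?K \<nu>)"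
    using bij_betw_inv_into_left[OF bij] K mem translate_gdual by metis
qed

section \<open>The Lie algebra and its Poisson operators\<close>

text \<open>
  The Lie bracket of \<open>Vect(S\<^sup>1) \<ltimes> C\<^sup>\<infinity>(S\<^sup>1)\<close>, with the sign for which the action of
  \<open>Vect(S\<^sup>1)\<close> on functions is \<open>\<rho> \<mapsto> u \<rho>'\<close>.
\<close>

definition bracket :: "fpair \<Rightarrow> fpair \<Rightarrow> fpair" where
  "bracket = (\<lambda>(u, \<rho>) (v, \<sigma>).
     ((\<lambda>x. u x * deriv v x - deriv u x * v x), (\<lambda>x. u x * deriv \<sigma> x - v x * deriv \<rho> x)))"

lemma bracket_gdual: "v \<in> gdual \<Longrightarrow> w \<in> gdual \<Longrightarrow> bracket v w \<in> gdual"
  by (elim gdual_cases) (auto simp: bracket_def intro!: circle_smooth_intros)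

lemma lie_poisson_gdual: "\<mu> \<in> gdual \<Longrightarrow> w \<in> gdual \<Longrightarrow> lie_poisson \<mu> w \<in> gdual"
  by (elim gdual_cases) (auto simp: lie_poisson_def intro!: circle_smooth_intros)

lemma lie_poisson_translate_left:
  assumes "\<mu> \<in> gdual" "\<nu> \<in> gdual"
  shows "lie_poisson (translate \<mu> t \<nu>) w = translate (lie_poisson \<mu> w) t (lie_poisson \<nu> w)"
  using assms
  by (elim gdual_cases, cases w)
     (auto simp: lie_poisson_def translate_def circle_smooth_deriv_lin algebra_simps)

lemma lie_poisson_translate_right:
  assumes "v \<in> gdual" "w \<in> gdual"
  shows "lie_poisson \<mu> (translate v t w) = translate (lie_poisson \<mu> v) t (lie_poisson \<mu> w)"
  using assms
  by (elim gdual_cases, cases \<mu>)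
     (auto simp: lie_poisson_def translate_def circle_smooth_deriv_lin algebra_simps)

text \<open>
  The Lie-Poisson operator is the coadjoint action: one integration by parts moves the derivatives
  off the point \<open>\<mu>\<close>.
\<close>

lemma pairing_lie_poisson:
  assumes "\<mu> \<in> gdual" "v \<in> gdual" "w \<in> gdual"
  shows "pairing (lie_poisson \<mu> v) w = pairing \<mu> (bracket w v)"
proof -
  obtain m p f g k l where eqs: "\<mu> = (m, p)" "v = (f, g)" "w = (k, l)"
    and smooth: "m \<in> circle_smooth" "p \<in> circle_smooth" "f \<in> circle_smooth" "g \<in> circle_smooth"
      "k \<in> circle_smooth" "l \<in> circle_smooth"
    using assms by (elim gdual_cases) blast
  note D = smooth[THEN circle_smooth_DERIV]
  show ?thesis
    unfolding eqs pairing_def lie_poisson_def bracket_def prod.case fst_conv snd_conv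
  proof (rule integral_eq_of_total_derivative)
    show "(\<lambda>x. m x * f x * k x + p x * f x * l x) \<in> circle_smooth"
      by (intro circle_smooth_intros smooth)
  next
    fix x
    show "((\<lambda>x. m x * f x * k x + p x * f x * l x) has_real_derivative
        (deriv m x * f x + 2 * m x * deriv f x + p x * deriv g x) * k x +
        (deriv p x * f x + p x * deriv f x) * l x -
        (m x * (k x * deriv f x - deriv k x * f x) + p x * (k x * deriv g x - f x * deriv l x))) (at x)"
      by (rule D derivative_eq_intros refl)+ (simp add: algebra_simps)
  qed (intro circle_smooth_intros smooth)+
qed

lemma modified_lie_poisson_linear: "gdual_linear (modified_lie_poisson m\<^sub>0 p\<^sub>0 c\<^sub>1 c\<^sub>2 c\<^sub>3)"
  unfolding gdual_linear_def
proof (intro ballI conjI allI)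
  fix \<mu> \<nu> t assume mem: "\<mu> \<in> gdual" "\<nu> \<in> gdual"
  show "modified_lie_poisson m\<^sub>0 p\<^sub>0 c\<^sub>1 c\<^sub>2 c\<^sub>3 \<mu> \<in> gdual"
    using mem by (elim gdual_cases) (auto simp: modified_lie_poisson_def intro!: circle_smooth_intros)
  show "modified_lie_poisson m\<^sub>0 p\<^sub>0 c\<^sub>1 c\<^sub>2 c\<^sub>3 (translate \<mu> t \<nu>) =
      translate (modified_lie_poisson m\<^sub>0 p\<^sub>0 c\<^sub>1 c\<^sub>2 c\<^sub>3 \<mu>) t (modified_lie_poisson m\<^sub>0 p\<^sub>0 c\<^sub>1 c\<^sub>2 c\<^sub>3 \<nu>)"
    using mem
    by (elim gdual_cases)
       (auto simp: modified_lie_poisson_def translate_def circle_smooth_deriv_lin iterated_deriv_lin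
          algebra_simps simp del: funpow.simps)
qed

lemma modified_lie_poisson_skew:
  assumes "v \<in> gdual" "w \<in> gdual"
  shows "pairing (modified_lie_poisson m\<^sub>0 p\<^sub>0 c\<^sub>1 c\<^sub>2 c\<^sub>3 v) w =
    - pairing v (modified_lie_poisson m\<^sub>0 p\<^sub>0 c\<^sub>1 c\<^sub>2 c\<^sub>3 w)"
proof -
  obtain f g k l where eqs: "v = (f, g)" "w = (k, l)"
    and smooth: "f \<in> circle_smooth" "g \<in> circle_smooth" "k \<in> circle_smooth" "l \<in> circle_smooth"
    using assms by (elim gdual_cases) blast
  note D = smooth[THEN circle_smooth_DERIV] smooth[THEN circle_smooth_deriv, THEN circle_smooth_DERIV]
    smooth[THEN circle_smooth_deriv, THEN circle_smooth_deriv, THEN circle_smooth_DERIV]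
  let ?F = "\<lambda>x. 2 * m\<^sub>0 * (f x * k x)
      - c\<^sub>1 * (deriv (deriv f) x * k x - deriv f x * deriv k x + f x * deriv (deriv k) x)
      + p\<^sub>0 * (g x * k x + f x * l x) + c\<^sub>2 * (deriv g x * k x - g x * deriv k x)
      - c\<^sub>2 * (deriv f x * l x - f x * deriv l x) + 2 * c\<^sub>3 * (g x * l x)"
  show ?thesis
    unfolding eqs pairing_def modified_lie_poisson_def prod.case fst_conv snd_conv
      Henstock_Kurzweil_Integration.integral_neg[symmetric] deriv_pow_2 deriv_pow_3
  proof (rule integral_eq_of_total_derivative[where F = ?F])
    fix x
    let ?L = "(2 * m\<^sub>0 * deriv f x - c\<^sub>1 * deriv (deriv (deriv f)) x + p\<^sub>0 * deriv g x
           + c\<^sub>2 * deriv (deriv g) x) * k x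
         + (p\<^sub>0 * deriv f x - c\<^sub>2 * deriv (deriv f) x + 2 * c\<^sub>3 * deriv g x) * l x"
    let ?R = "- (f x * (2 * m\<^sub>0 * deriv k x - c\<^sub>1 * deriv (deriv (deriv k)) x + p\<^sub>0 * deriv l x
           + c\<^sub>2 * deriv (deriv l) x)
         + g x * (p\<^sub>0 * deriv k x - c\<^sub>2 * deriv (deriv k) x + 2 * c\<^sub>3 * deriv l x))"
    show "(?F has_real_derivative ?L - ?R) (at x)"
      by (rule D derivative_eq_intros refl)+ (simp add: algebra_simps)
  qed (intro circle_smooth_intros smooth)+
qed

text \<open>
  The \<open>2\<close>-cocycle identity on which compatibility with \<open>lie_poisson\<close> rests. After cyclic summation the
  coefficients of \<open>m\<^sub>0\<close> and \<open>c\<^sub>3\<close> are \<open>3 \<times> 3\<close> determinants with two equal rows, and that of \<open>p\<^sub>0\<close> is a sum of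
  two determinants that differ by an exchange of rows; they vanish
  pointwise, while those of \<open>c\<^sub>1\<close> and \<open>c\<^sub>2\<close> are, up to sign, the derivatives of the determinants
  with rows \<open>f'', f, f'\<close> and \<open>g', f, f'\<close>, where \<open>(f, g)\<close> runs through the three arguments.
\<close>

lemma modified_lie_poisson_cocycle:
  fixes m\<^sub>0 p\<^sub>0 c\<^sub>1 c\<^sub>2 c\<^sub>3 :: real
  defines "J \<equiv> modified_lie_poisson m\<^sub>0 p\<^sub>0 c\<^sub>1 c\<^sub>2 c\<^sub>3"
  assumes "v \<in> gdual" "w \<in> gdual" "z \<in> gdual"
  shows "pairing (J v) (bracket w z) + pairing (J w) (bracket z v) + pairing (J z) (bracket v w) = 0"
proof -
  obtain f g k l r s where eqs: "v = (f, g)" "w = (k, l)" "z = (r, s)"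
    and smooth: "f \<in> circle_smooth" "g \<in> circle_smooth" "k \<in> circle_smooth" "l \<in> circle_smooth"
       "r \<in> circle_smooth" "s \<in> circle_smooth"
    using assms by (elim gdual_cases) blast
  note D = smooth[THEN circle_smooth_DERIV] smooth[THEN circle_smooth_deriv, THEN circle_smooth_DERIV]
    smooth[THEN circle_smooth_deriv, THEN circle_smooth_deriv, THEN circle_smooth_DERIV]
  \<comment> \<open>The primitive: determinants with rows \<open>g', f, f'\<close> and \<open>f'', f, f'\<close>, the columns being \<open>v\<close>, \<open>w\<close>, \<open>z\<close>.\<close>
  define F where "F = (\<lambda>x.
    c\<^sub>2 * (deriv g x * (k x * deriv r x - deriv k x * r x)
        + deriv l x * (r x * deriv f x - deriv r x * f x)
        + deriv s x * (f x * deriv k x - deriv f x * k x))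
    - c\<^sub>1 * (deriv (deriv f) x * (k x * deriv r x - deriv k x * r x)
        + deriv (deriv k) x * (r x * deriv f x - deriv r x * f x)
        + deriv (deriv r) x * (f x * deriv k x - deriv f x * k x)))"
  define I where "I v w z x = fst (J v) x * fst (bracket w z) x + snd (J v) x * snd (bracket w z) x"
    for v w z x
  have int: "I a b c \<in> circle_smooth" if "a \<in> gdual" "b \<in> gdual" "c \<in> gdual" for a b c
    unfolding I_def J_def using that
    by (intro circle_smooth_intros gdual_fst gdual_snd bracket_gdual
        gdual_linear_mem[OF modified_lie_poisson_linear])
  have "pairing (J v) (bracket w z) + pairing (J w) (bracket z v) + pairing (J z) (bracket v w)
      = integral {0..2 * pi} (\<lambda>x. I v w z x + I w z v x + I z v w x)"
    using assms(2-4)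
    by (simp add: pairing_def I_def[symmetric] Henstock_Kurzweil_Integration.integral_add
        integrable_add circle_smooth_integrable int)
  also have "\<dots> = integral {0..2 * pi} (\<lambda>x. 0)"
  proof (rule integral_eq_of_total_derivative[where F = F])
    show "F \<in> circle_smooth"
      unfolding F_def by (intro circle_smooth_intros smooth)
    fix x
    show "(F has_real_derivative I v w z x + I w z v x + I z v w x - 0) (at x)"
      unfolding F_def I_def J_def eqs modified_lie_poisson_def bracket_def prod.case fst_conv snd_conv
        deriv_pow_2 deriv_pow_3
      by (rule D derivative_eq_intros refl)+ (simp add: algebra_simps)
  qed (intro circle_smooth_intros int assms)+
  finally show ?thesis by simp
qed

section \<open>Inertia operators\<close>

lemma integral_parts_iterated:
  assumes "f \<in> circle_smooth" "g \<in> circle_smooth"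
  shows "integral {0..2 * pi} (\<lambda>x. (deriv ^^ i) f x * g x) =
    (-1) ^ i * integral {0..2 * pi} (\<lambda>x. f x * (deriv ^^ i) g x)"
  using assms(2)
proof (induction i arbitrary: g)
  case (Suc i)
  note smooth = circle_smooth_iterated_deriv[OF assms(1), of i] Suc.prems
  note D = smooth[THEN circle_smooth_DERIV]
  have "integral {0..2 * pi} (\<lambda>x. (deriv ^^ Suc i) f x * g x) =
      integral {0..2 * pi} (\<lambda>x. - ((deriv ^^ i) f x * deriv g x))"
  proof (rule integral_eq_of_total_derivative)
    show "((\<lambda>x. (deriv ^^ i) f x * g x) has_real_derivative
        (deriv ^^ Suc i) f x * g x - - ((deriv ^^ i) f x * deriv g x)) (at x)" for x
      by (rule D derivative_eq_intros refl)+ simp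
  qed (intro circle_smooth_intros assms Suc.prems)+
  also have "\<dots> = - ((-1) ^ i * integral {0..2 * pi} (\<lambda>x. f x * (deriv ^^ i) (deriv g) x))"
    by (simp add: Suc.IH[OF circle_smooth_deriv[OF Suc.prems]])
  finally show ?case
    by (simp add: funpow_swap1)
qed simp

lemma inertia_operator_linear: "gdual_linear (inertia_operator n\<^sub>0 n\<^sub>1 a b \<gamma> \<epsilon>)"
  unfolding gdual_linear_def
proof (intro ballI conjI allI)
  fix \<mu> \<nu> t assume mem: "\<mu> \<in> gdual" "\<nu> \<in> gdual"
  show "inertia_operator n\<^sub>0 n\<^sub>1 a b \<gamma> \<epsilon> \<mu> \<in> gdual"
    using mem by (elim gdual_cases) (auto simp: inertia_operator_def intro!: circle_smooth_intros)
  show "inertia_operator n\<^sub>0 n\<^sub>1 a b \<gamma> \<epsilon> (translate \<mu> t \<nu>) =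
      translate (inertia_operator n\<^sub>0 n\<^sub>1 a b \<gamma> \<epsilon> \<mu>) t (inertia_operator n\<^sub>0 n\<^sub>1 a b \<gamma> \<epsilon> \<nu>)"
    using mem
    by (elim gdual_cases)
       (auto simp: inertia_operator_def translate_def iterated_deriv_lin sum.distrib
          sum_distrib_left algebra_simps)
qed

text \<open>
  Even powers of \<open>\<partial>\<close> are symmetric, and the signs \<open>(-1)\<^sup>i\<close> in the upper right entry make it the
  adjoint of the lower left one. The proof expands the pairing into elementary integrals and
  moves all derivatives across.
\<close>

lemma inertia_operator_symmetric:
  fixes n\<^sub>0 n\<^sub>1 :: nat and a b :: "nat \<Rightarrow> real" and \<gamma> \<epsilon> :: real
  defines "M \<equiv> inertia_operator n\<^sub>0 n\<^sub>1 a b \<gamma> \<epsilon>"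
  assumes "v \<in> gdual" "w \<in> gdual"
  shows "pairing (M v) w = pairing v (M w)"
proof -
  define I where "I f = integral {0..2 * pi} f" for f :: "real \<Rightarrow> real"
  have add: "I (\<lambda>x. f x + g x) = I f + I g" and diff: "I (\<lambda>x. f x - g x) = I f - I g"
    if "f \<in> circle_smooth" "g \<in> circle_smooth" for f g
    using that by (simp_all add: I_def Henstock_Kurzweil_Integration.integral_add
        Henstock_Kurzweil_Integration.integral_diff circle_smooth_integrable)
  have cmult: "I (\<lambda>x. c * f x) = c * I f" for c f
    by (simp add: I_def)
  have sum: "I (\<lambda>x. \<Sum>i\<in>S. f i x) = (\<Sum>i\<in>S. I (f i))"
    if "finite S" "\<And>i. f i \<in> circle_smooth" for S :: "nat set" and f
    using that by (simp add: I_def integral_sum circle_smooth_integrable)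
  have parts: "I (\<lambda>x. (deriv ^^ i) f x * g x) = (-1) ^ i * I (\<lambda>x. f x * (deriv ^^ i) g x)"
    if "f \<in> circle_smooth" "g \<in> circle_smooth" for f g i
    using integral_parts_iterated[OF that] by (simp add: I_def)
  have expand: "pairing (M (f, g)) (k, l) =
      \<epsilon> * I (\<lambda>x. f x * k x) - \<epsilon> * I (\<lambda>x. (deriv ^^ 2) f x * k x)
      + (\<Sum>i=2..n\<^sub>0. a i * I (\<lambda>x. (deriv ^^ (2 * i)) f x * k x))
      + (\<Sum>i=0..n\<^sub>1. b i * ((-1) ^ i * I (\<lambda>x. (deriv ^^ i) g x * k x)))
      + (\<Sum>i=0..n\<^sub>1. b i * I (\<lambda>x. (deriv ^^ i) f x * l x))
      + \<gamma> * I (\<lambda>x. g x * l x)"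
    if smooth: "f \<in> circle_smooth" "g \<in> circle_smooth" "k \<in> circle_smooth" "l \<in> circle_smooth"
    for f g k l
  proof -
    have "pairing (M (f, g)) (k, l) = I (\<lambda>x. \<epsilon> * (f x * k x) - \<epsilon> * ((deriv ^^ 2) f x * k x)
      + (\<Sum>i=2..n\<^sub>0. a i * ((deriv ^^ (2 * i)) f x * k x))
      + (\<Sum>i=0..n\<^sub>1. (b i * (-1) ^ i) * ((deriv ^^ i) g x * k x))
      + (\<Sum>i=0..n\<^sub>1. b i * ((deriv ^^ i) f x * l x))
      + \<gamma> * (g x * l x))"
      unfolding M_def pairing_def inertia_operator_def I_def prod.case fst_conv snd_conv
      by (simp add: algebra_simps sum_distrib_left sum_distrib_right)
    also have "\<dots> = \<epsilon> * I (\<lambda>x. f x * k x) - \<epsilon> * I (\<lambda>x. (deriv ^^ 2) f x * k x)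
      + (\<Sum>i=2..n\<^sub>0. a i * I (\<lambda>x. (deriv ^^ (2 * i)) f x * k x))
      + (\<Sum>i=0..n\<^sub>1. (b i * (-1) ^ i) * I (\<lambda>x. (deriv ^^ i) g x * k x))
      + (\<Sum>i=0..n\<^sub>1. b i * I (\<lambda>x. (deriv ^^ i) f x * l x))
      + \<gamma> * I (\<lambda>x. g x * l x)"
      by (subst add diff sum; (intro circle_smooth_intros smooth finite_atLeastAtMost)?)+
         (simp only: cmult)
    finally show ?thesis by (simp add: mult.assoc)
  qed
  obtain f g k l where eqs: "v = (f, g)" "w = (k, l)"
    and smooth: "f \<in> circle_smooth" "g \<in> circle_smooth" "k \<in> circle_smooth" "l \<in> circle_smooth"
    using assms(2,3) by (elim gdual_cases) blast
  have sign: "(-1) ^ i * ((-1) ^ i * y) = (y :: real)" for i y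
    by (metis (no_types) left_minus_one_mult_self)
  have move: "I (\<lambda>x. (deriv ^^ i) r x * s x) = (-1) ^ i * I (\<lambda>x. (deriv ^^ i) s x * r x)"
    if "r \<in> circle_smooth" "s \<in> circle_smooth" for r s i
    using parts[OF that] by (simp add: mult.commute[of "r _"])
  have moves: "I (\<lambda>x. (deriv ^^ 2) f x * k x) = I (\<lambda>x. (deriv ^^ 2) k x * f x)"
    "I (\<lambda>x. (deriv ^^ (2 * i)) f x * k x) = I (\<lambda>x. (deriv ^^ (2 * i)) k x * f x)"
    "(-1) ^ i * I (\<lambda>x. (deriv ^^ i) g x * k x) = I (\<lambda>x. (deriv ^^ i) k x * g x)"
    "(-1) ^ i * I (\<lambda>x. (deriv ^^ i) l x * f x) = I (\<lambda>x. (deriv ^^ i) f x * l x)"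
    "I (\<lambda>x. f x * k x) = I (\<lambda>x. k x * f x)" "I (\<lambda>x. g x * l x) = I (\<lambda>x. l x * g x)" for i
    using move[OF smooth(1,3), of 2] move[OF smooth(1,3), of "2 * i"]
      move[OF smooth(2,3), of i] move[OF smooth(4,1), of i]
    by (simp_all only: sign power_mult power2_minus power_one mult_1 mult.commute[of "f _"] mult.commute[of "g _"])
  have "pairing (M v) w = pairing (M w) v"
    unfolding eqs expand[OF smooth] expand[OF smooth(3,4,1,2)] moves by simp
  then show ?thesis by (simp add: pairing_commute)
qed

text \<open>
  The kinetic energy is the quadratic form of the symmetric operator \<open>inv_into gdual M\<close>, which is therefore its
  gradient.
\<close>

lemma kinetic_energy_gradient:
  assumes lin: "gdual_linear M" and bij: "bij_betw M gdual gdual"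
    and sym: "\<And>v w. v \<in> gdual \<Longrightarrow> w \<in> gdual \<Longrightarrow> pairing (M v) w = pairing v (M w)"
    and \<mu>: "\<mu> \<in> gdual"
  shows "has_L2_gradient (kinetic_energy M) \<mu> (inv_into gdual M \<mu>)"
  unfolding has_L2_gradient_def
proof (intro conjI ballI)
  let ?K = "inv_into gdual M"
  have K_lin: "gdual_linear ?K"
    by (rule gdual_linear_inv[OF lin bij])
  have K: "?K \<nu> \<in> gdual" "M (?K \<nu>) = \<nu>" if "\<nu> \<in> gdual" for \<nu>
    using that bij gdual_linear_mem[OF K_lin] by (auto simp: bij_betw_inv_into_right)
  show "?K \<mu> \<in> gdual" by (rule K[OF \<mu>])
  fix \<nu> assume \<nu>: "\<nu> \<in> gdual"
  have K_sym: "pairing \<mu> (?K \<nu>) = pairing (?K \<mu>) \<nu>"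
    using sym[OF K(1)[OF \<mu>] K(1)[OF \<nu>]] K \<mu> \<nu> by simp
  have "kinetic_energy M (translate \<mu> t \<nu>) =
      1 / 2 * pairing \<mu> (?K \<mu>) + t * pairing (?K \<mu>) \<nu> + t\<^sup>2 / 2 * pairing \<nu> (?K \<nu>)" for t
    unfolding kinetic_energy_def gdual_linear_translate[OF K_lin \<mu> \<nu>]
    using \<mu> \<nu> K K_sym pairing_commute[of \<nu> "?K \<mu>"]
    by (simp add: pairing_translate pairing_translate_right translate_gdual
        power2_eq_square algebra_simps)
  then show "((\<lambda>t. kinetic_energy M (translate \<mu> t \<nu>)) has_real_derivative pairing (?K \<mu>) \<nu>) (at 0)"
    by (auto intro!: derivative_eq_intros)
qed

lemma euler_field_eq:
  assumes "gdual_linear M" "bij_betw M gdual gdual"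
    and "\<And>v w. v \<in> gdual \<Longrightarrow> w \<in> gdual \<Longrightarrow> pairing (M v) w = pairing v (M w)"
    and w: "w \<in> gdual"
  shows "euler_field M (M w) = lie_poisson (M w) w"
  using L2_gradient_eqI[OF kinetic_energy_gradient[OF assms(1-3) gdual_linear_mem[OF assms(1) w]]]
    bij_betw_inv_into_left[OF assms(2) w]
  by (simp add: euler_field_def)

section \<open>A second Hamiltonian makes the recursion operator a derivation\<close>

lemma DERIV_along_line:
  assumes grad: "\<And>\<mu>. \<mu> \<in> gdual \<Longrightarrow> has_L2_gradient H \<mu> (G \<mu>)"
    and "\<mu> \<in> gdual" "\<nu> \<in> gdual"
  shows "((\<lambda>t. H (translate \<mu> t \<nu>)) has_real_derivative pairing (G (translate \<mu> t \<nu>)) \<nu>) (at t)"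
proof -
  have "((\<lambda>h. H (translate (translate \<mu> t \<nu>) h \<nu>)) has_real_derivative
      pairing (G (translate \<mu> t \<nu>)) \<nu>) (at 0)"
    using grad[OF translate_gdual[OF assms(2,3)]] assms(3) unfolding has_L2_gradient_def by blast
  moreover have "translate (translate \<mu> t \<nu>) h \<nu> = translate \<mu> (h + t) \<nu>" for h
    by (simp add: translate_def algebra_simps)
  ultimately show ?thesis
    using DERIV_shift[of "\<lambda>t. H (translate \<mu> t \<nu>)" _ 0 t] by simp
qed

text \<open>
  Equality of mixed partial derivatives at the origin, for a function of two variables whose partial
  derivatives are quadratic polynomials. The first of them determines the function up to a function
  of \<open>t\<close>.
\<close>

lemma mixed_coefficients_agree:
  fixes F :: "real \<Rightarrow> real \<Rightarrow> real"
  assumes Fs: "\<And>s t. ((\<lambda>s. F s t) has_real_derivative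
      p\<^sub>0 + p\<^sub>1 * s + p\<^sub>2 * t + p\<^sub>3 * s\<^sup>2 + p\<^sub>4 * (s * t) + p\<^sub>5 * t\<^sup>2) (at s)"
    and Ft: "\<And>s t. ((\<lambda>t. F s t) has_real_derivative
      q\<^sub>0 + q\<^sub>1 * s + q\<^sub>2 * t + q\<^sub>3 * s\<^sup>2 + q\<^sub>4 * (s * t) + q\<^sub>5 * t\<^sup>2) (at t)"
  shows "p\<^sub>2 = q\<^sub>1"
proof -
  let ?P = "\<lambda>s t. p\<^sub>0 * s + (p\<^sub>1 / 2) * s\<^sup>2 + p\<^sub>2 * (s * t) + (p\<^sub>3 / 3) * s ^ 3
      + (p\<^sub>4 / 2) * (s\<^sup>2 * t) + p\<^sub>5 * (s * t\<^sup>2)"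
  have F: "F s t = F 0 t + ?P s t" for s t
  proof -
    have "((\<lambda>s. F s t - ?P s t) has_real_derivative 0) (at s)" for s
      by (rule Fs derivative_eq_intros refl)+ (simp add: algebra_simps power2_eq_square)
    then have "F s t - ?P s t = F 0 t - ?P 0 t"
      using DERIV_isconst_all[of "\<lambda>s. F s t - ?P s t"] by blast
    then show ?thesis by simp
  qed
  have "q\<^sub>0 + q\<^sub>1 * s + q\<^sub>3 * s\<^sup>2 = q\<^sub>0 + p\<^sub>2 * s + p\<^sub>4 * s\<^sup>2 / 2" for s
  proof (rule DERIV_unique)
    show "((\<lambda>t. F s t) has_real_derivative q\<^sub>0 + q\<^sub>1 * s + q\<^sub>3 * s\<^sup>2) (at 0)"
      using Ft[of s 0] by simp
    have F0: "((\<lambda>t. F 0 t) has_real_derivative q\<^sub>0) (at 0)"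
      using Ft[of 0 0] by simp
    have "((\<lambda>t. F 0 t + ?P s t) has_real_derivative q\<^sub>0 + p\<^sub>2 * s + p\<^sub>4 * s\<^sup>2 / 2) (at 0)"
      by (rule F0 derivative_eq_intros refl)+ simp
    then show "((\<lambda>t. F s t) has_real_derivative q\<^sub>0 + p\<^sub>2 * s + p\<^sub>4 * s\<^sup>2 / 2) (at 0)"
      unfolding F[of s] .
  qed
  from this[of 1] this[of "- 1"] show ?thesis by simp
qed

text \<open>
  Along the direction \<open>J v\<close> the second Hamiltonian has slope \<open>-\<langle>X, v\<rangle>\<close>, by skewness of \<open>J\<close>, where \<open>X\<close>
  is the Euler field. So on the plane \<open>\<mu> + s J v + t J w\<close> both partial derivatives of \<open>H\<close> are known,
  and they are quadratic because \<open>X\<close> is. Their mixed coefficients must agree. This is where the existence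
  of \<open>H\<close> enters; it does so without inverting the possibly degenerate operator \<open>J\<close>.
\<close>

lemma linearized_field_symmetric:
  assumes J_lin: "gdual_linear J"
    and skew: "\<And>v w. v \<in> gdual \<Longrightarrow> w \<in> gdual \<Longrightarrow> pairing (J v) w = - pairing v (J w)"
    and M_lin: "gdual_linear M"
    and D: "\<And>v. v \<in> gdual \<Longrightarrow> D v \<in> gdual \<and> M (D v) = J v"
    and grad: "\<And>\<mu>. \<mu> \<in> gdual \<Longrightarrow> has_L2_gradient H \<mu> (G \<mu>)"
    and ham: "\<And>w. w \<in> gdual \<Longrightarrow> lie_poisson (M w) w = J (G (M w))"
    and mem: "v \<in> gdual" "w \<in> gdual" "z \<in> gdual"
  shows "pairing (lie_poisson (M z) (D w)) v + pairing (lie_poisson (J w) z) v =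
    pairing (lie_poisson (M z) (D v)) w + pairing (lie_poisson (J v) z) w"
proof -
  define C where "C a b c = pairing (lie_poisson (M a) b) c" for a b c
  have C_mem: "lie_poisson (M a) b \<in> gdual" if "a \<in> gdual" "b \<in> gdual" for a b
    using that by (intro lie_poisson_gdual gdual_linear_mem[OF M_lin])
  have C_left: "C (translate a t a') b c = C a b c + t * C a' b c"
    and C_mid: "C b (translate a t a') c = C b a c + t * C b a' c"
    if "a \<in> gdual" "a' \<in> gdual" "b \<in> gdual" "c \<in> gdual" for a a' b c t
    using that unfolding C_def
    by (simp_all add: gdual_linear_translate[OF M_lin] lie_poisson_translate_left
        lie_poisson_translate_right gdual_linear_mem[OF M_lin] pairing_translate C_mem)
  have slope: "((\<lambda>t. H (translate (M a) t (J b))) has_real_derivative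
      - C (translate a t (D b)) (translate a t (D b)) b) (at t)"
    if "a \<in> gdual" "b \<in> gdual" for a b t
  proof -
    have eq: "translate (M a) t (J b) = M (translate a t (D b))"
      using that D gdual_linear_translate[OF M_lin] by simp
    have pt: "translate a t (D b) \<in> gdual"
      using that D by (intro translate_gdual) auto
    have "G (M (translate a t (D b))) \<in> gdual"
      using grad[OF gdual_linear_mem[OF M_lin pt]] by (simp add: has_L2_gradient_def)
    then have "pairing (G (translate (M a) t (J b))) (J b) =
        - C (translate a t (D b)) (translate a t (D b)) b"
      using skew[OF _ that(2)] ham[OF pt] unfolding eq C_def by simp
    then show ?thesis
      using DERIV_along_line[OF grad, of "M a" "J b" t] that
        gdual_linear_mem[OF M_lin] gdual_linear_mem[OF J_lin] by simp
  qed
  have Dv: "D v \<in> gdual" and Dw: "D w \<in> gdual"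
    using D mem by auto
  \<comment> \<open>Since \<open>M D = J\<close>, the plane through \<open>M z\<close> spanned by \<open>J v\<close>, \<open>J w\<close> is the image under \<open>M\<close> of this one.\<close>
  let ?pt = "\<lambda>s t. translate (translate z s (D v)) t (D w)"
  define F where "F s t = H (M (?pt s t))" for s t
  have M_pt: "M (?pt s t) = translate (M (translate z s (D v))) t (J w)" for s t
    using mem D gdual_linear_translate[OF M_lin] translate_gdual by simp
  have swap: "?pt s t = translate (translate z t (D w)) s (D v)" for s t
    by (simp add: translate_def algebra_simps)
  have M_pt': "M (?pt s t) = translate (M (translate z t (D w))) s (J v)" for s t
    unfolding swap using mem D gdual_linear_translate[OF M_lin] translate_gdual by simp
  have expand: "- C (?pt s t) (?pt s t) c = - C z z c
      + - (C z (D v) c + C (D v) z c) * s + - (C z (D w) c + C (D w) z c) * t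
      + - C (D v) (D v) c * s\<^sup>2 + - (C (D v) (D w) c + C (D w) (D v) c) * (s * t)
      + - C (D w) (D w) c * t\<^sup>2" if "c \<in> gdual" for s t c
    using mem Dv Dw that
    by (simp add: C_left C_mid translate_gdual algebra_simps power2_eq_square)
  have "- (C z (D w) v + C (D w) z v) = - (C z (D v) w + C (D v) z w)"
  proof (rule mixed_coefficients_agree)
    fix s t
    show "((\<lambda>s. F s t) has_real_derivative - C z z v
      + - (C z (D v) v + C (D v) z v) * s + - (C z (D w) v + C (D w) z v) * t
      + - C (D v) (D v) v * s\<^sup>2 + - (C (D v) (D w) v + C (D w) (D v) v) * (s * t)
      + - C (D w) (D w) v * t\<^sup>2) (at s)"
      unfolding F_def M_pt' expand[OF mem(1), symmetric] unfolding swap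
      by (intro slope translate_gdual mem Dw)
    show "((\<lambda>t. F s t) has_real_derivative - C z z w
      + - (C z (D v) w + C (D v) z w) * s + - (C z (D w) w + C (D w) z w) * t
      + - C (D v) (D v) w * s\<^sup>2 + - (C (D v) (D w) w + C (D w) (D v) w) * (s * t)
      + - C (D w) (D w) w * t\<^sup>2) (at t)"
      unfolding F_def M_pt expand[OF mem(2), symmetric]
      by (intro slope translate_gdual mem Dv)
  qed
  then show ?thesis
    using D mem by (simp add: C_def)
qed

text \<open>
  The symmetry of the linearized Euler field, rewritten with the coadjoint form of \<open>lie_poisson\<close> and
  the cocycle identity for \<open>J\<close>, says exactly that \<open>D = inv M \<circ> J\<close> is a derivation of the Lie algebra: the
  right-hand side is \<open>[v, D w] + [D v, w]\<close>. The point \<open>\<mu> = M z\<close> is arbitrary and can be stripped off.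
\<close>

lemma recursion_operator_derivation:
  fixes m\<^sub>0 p\<^sub>0 c\<^sub>1 c\<^sub>2 c\<^sub>3 :: real
  defines "J \<equiv> modified_lie_poisson m\<^sub>0 p\<^sub>0 c\<^sub>1 c\<^sub>2 c\<^sub>3"
  assumes M_lin: "gdual_linear M" and surj: "\<And>\<mu>. \<mu> \<in> gdual \<Longrightarrow> \<exists>w\<in>gdual. M w = \<mu>"
    and sym: "\<And>v w. v \<in> gdual \<Longrightarrow> w \<in> gdual \<Longrightarrow> pairing (M v) w = pairing v (M w)"
    and D: "\<And>v. v \<in> gdual \<Longrightarrow> D v \<in> gdual \<and> M (D v) = J v"
    and grad: "\<And>\<mu>. \<mu> \<in> gdual \<Longrightarrow> has_L2_gradient H \<mu> (G \<mu>)"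
    and ham: "\<And>w. w \<in> gdual \<Longrightarrow> lie_poisson (M w) w = J (G (M w))"
    and mem: "v \<in> gdual" "w \<in> gdual"
  shows "D (bracket v w) = translate (bracket v (D w)) (- 1) (bracket w (D v))"
proof (rule pairing_nondegenerate)
  have J_lin: "gdual_linear J" and
    skew: "\<And>v w. v \<in> gdual \<Longrightarrow> w \<in> gdual \<Longrightarrow> pairing (J v) w = - pairing v (J w)"
    unfolding J_def by (rule modified_lie_poisson_linear, rule modified_lie_poisson_skew)
  have Dv: "D v \<in> gdual" and Dw: "D w \<in> gdual"
    using D mem by auto
  note br = bracket_gdual
  show "D (bracket v w) \<in> gdual" "translate (bracket v (D w)) (- 1) (bracket w (D v)) \<in> gdual"
    using D mem by (simp_all add: br translate_gdual)
  fix \<mu> assume "\<mu> \<in> gdual"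
  then obtain z where z: "z \<in> gdual" "M z = \<mu>"
    using surj by blast
  have mems: "J v \<in> gdual" "J w \<in> gdual" "\<mu> \<in> gdual"
    using mem gdual_linear_mem[OF J_lin] \<open>\<mu> \<in> gdual\<close> by auto
  have "pairing \<mu> (bracket v (D w)) + pairing (J w) (bracket v z) =
      pairing \<mu> (bracket w (D v)) + pairing (J v) (bracket w z)"
    using linearized_field_symmetric[OF J_lin skew M_lin D grad ham mem z(1)]
    by (simp add: pairing_lie_poisson mem z Dv Dw mems)
  moreover have "pairing (J v) (bracket w z) + pairing (J w) (bracket z v) + pairing (J z) (bracket v w) = 0"
    unfolding J_def by (rule modified_lie_poisson_cocycle[OF mem z(1)])
  moreover have "pairing (J w) (bracket z v) = - pairing (J w) (bracket v z)"
  proof -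
    have "bracket z v = translate (bracket v z) (- 2) (bracket v z)"
      by (cases v; cases z) (simp add: bracket_def translate_def algebra_simps)
    then show ?thesis
      using mem z mems by (simp add: pairing_translate_right br)
  qed
  moreover have "pairing (J z) (bracket v w) = - pairing (D (bracket v w)) \<mu>"
    using skew[OF z(1) br[OF mem]] sym[OF z(1), of "D (bracket v w)"] D[OF br[OF mem]] z
    by (simp add: pairing_commute)
  ultimately show "pairing (D (bracket v w)) \<mu> =
      pairing (translate (bracket v (D w)) (- 1) (bracket w (D v))) \<mu>"
    using pairing_translate[OF br[OF mem(1) Dw] br[OF mem(2) Dv] mems(3), of "- 1"]
    by (simp add: pairing_commute)
qed

section \<open>The form of the recursion operator\<close>

lemma iterated_deriv_cmult:
  assumes "f \<in> circle_smooth"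
  shows "(deriv ^^ k) (\<lambda>x. t * f x) = (\<lambda>x. t * (deriv ^^ k) f x)"
  using iterated_deriv_lin[OF circle_smooth_const[of 0] assms, of k t]
  by (simp add: iterated_deriv_zero)

lemma gdual_linear_zero:
  assumes "gdual_linear L"
  shows "L ((\<lambda>x. 0), (\<lambda>x. 0)) = ((\<lambda>x. 0), (\<lambda>x. 0))"
proof -
  let ?z = "((\<lambda>x. 0), (\<lambda>x. 0)) :: fpair"
  have z: "?z \<in> gdual" by (simp add: circle_smooth_const)
  have "translate v (- 1) v = ?z" for v
    by (simp add: translate_def)
  then show ?thesis
    using gdual_linear_translate[OF assms z z, of "- 1"] by simp
qed

text \<open>
  Linear independence of the operators \<open>\<partial>\<^sup>s\<^sup>i\<^sup>+\<^sup>1\<close>, tested on waves: the value at \<open>0\<close> is a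
  polynomial in the \<open>s\<close>-th power of the frequency, so its coefficients vanish as soon as it vanishes
  at all frequencies. The extra derivative is present because the identities to be compared
  come composed with \<open>\<partial>\<close>, and the stride \<open>s\<close> serves operators containing only even powers.
\<close>

lemma derivative_coefficients_vanish:
  fixes e :: "nat \<Rightarrow> real"
  assumes s: "s > 0"
    and zero: "\<And>f. f \<in> circle_smooth \<Longrightarrow> (\<Sum>i\<le>n. e i * (deriv ^^ (s * i + 1)) f 0) = 0"
    and j: "j \<le> n"
  shows "e j = 0"
proof -
  \<comment> \<open>With this phase the \<open>j\<close>-th derivative term has the factor \<open>sin (\<pi> / 2) = 1\<close>.\<close>
  define \<theta> where "\<theta> = - (real (s * j) * (pi / 2))"
  define d where "d i = e i * sin (\<theta> + real (s * i + 1) * (pi / 2))" for i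
  have root: "(\<Sum>i\<le>n. d i * (real (Suc k) ^ s) ^ i) = 0" for k
  proof -
    have smooth: "(\<lambda>x. sin (real (Suc k) * x + \<theta>)) \<in> circle_smooth"
      using sin_wave_circle_smooth[of 1 "Suc k" \<theta>] by simp
    have "0 = (\<Sum>i\<le>n. e i * (real (Suc k) ^ (s * i + 1) * sin (\<theta> + real (s * i + 1) * (pi / 2))))"
      using zero[OF smooth] unfolding iterated_deriv_sin_wave by simp
    also have "\<dots> = real (Suc k) * (\<Sum>i\<le>n. d i * (real (Suc k) ^ s) ^ i)"
    proof -
      have "real (Suc k) ^ (s * i + 1) = real (Suc k) * (real (Suc k) ^ s) ^ i" for i
        by (simp add: power_mult)
      then show ?thesis
        unfolding d_def sum_distrib_left by (intro sum.cong refl) (simp only: ac_simps)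
    qed
    finally show ?thesis by simp
  qed
  have "inj (\<lambda>k. real (Suc k) ^ s)"
    using s by (auto intro!: injI dest: power_inject_base[of _ s _] simp: power_eq_iff_eq_base)
  then have "infinite (range (\<lambda>k. real (Suc k) ^ s))"
    by (rule range_inj_infinite)
  then have "infinite {x. (\<Sum>i\<le>n. d i * x ^ i) = 0}"
    by (rule infinite_super[rotated]) (use root in blast)
  then have "d j = 0"
    using polyfun_finite_roots[of d n] j by blast
  moreover have "\<theta> + real (s * j + 1) * (pi / 2) = pi / 2"
    by (simp add: \<theta>_def field_simps)
  ultimately show ?thesis
    unfolding d_def by (simp only: sin_pi_half mult_1_right)
qed

lemma inertia_operator_gamma_pos:
  assumes "strictly_positive (inertia_operator n\<^sub>0 n\<^sub>1 a b \<gamma> \<epsilon>)"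
  shows "\<gamma> > 0"
proof -
  let ?w = "((\<lambda>x. 0), (\<lambda>x. 1)) :: fpair"
  have "pairing ?w (inertia_operator n\<^sub>0 n\<^sub>1 a b \<gamma> \<epsilon> ?w) > 0"
    using assms circle_smooth_const unfolding strictly_positive_def
    by (metis mem_gdual prod.inject zero_neq_one)
  then show ?thesis
    by (simp add: pairing_def inertia_operator_def iterated_deriv_zero zero_less_mult_iff)
qed

text \<open>
  Let \<open>P \<rho>\<close> be the \<open>Vect(S\<^sup>1)\<close> part of \<open>D (0, \<rho>)\<close>. The vanishing bracket of \<open>(0, \<rho>)\<close> and \<open>(0, \<tau>)\<close> makes
  \<open>P \<rho>\<close> proportional to \<open>\<rho>'\<close>, with the same factor for all \<open>\<rho>\<close>, whereas the bracket with \<open>(u, 0)\<close> yields a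
  Leibniz rule with the opposite sign, \<open>P (u \<rho>') = u (P \<rho>)' - u' P \<rho>\<close>. The two are incompatible unless \<open>P = 0\<close>.
  It suffices to test with \<open>sin\<close> and \<open>cos\<close>, whose derivatives have no common zero.
\<close>

lemma derivation_on_second_factor:
  assumes D: "gdual_linear D"
    and der: "\<And>v w. v \<in> gdual \<Longrightarrow> w \<in> gdual \<Longrightarrow>
      D (bracket v w) = translate (bracket v (D w)) (- 1) (bracket w (D v))"
    and \<sigma>: "\<sigma> \<in> circle_smooth"
  shows "fst (D ((\<lambda>x. 0), \<sigma>)) = (\<lambda>x. 0)"
proof -
  define P where "P \<rho> = fst (D ((\<lambda>x. 0), \<rho>))" for \<rho>
  have P_smooth: "P \<rho> \<in> circle_smooth" if "\<rho> \<in> circle_smooth" for \<rho>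
    unfolding P_def using that
    by (intro gdual_fst gdual_linear_mem[OF D]) (simp add: circle_smooth_const)
  have commute: "P \<rho> x * deriv \<tau> x = P \<tau> x * deriv \<rho> x"
    if "\<rho> \<in> circle_smooth" "\<tau> \<in> circle_smooth" for \<rho> \<tau> x
  proof -
    let ?v = "((\<lambda>x. 0), \<rho>) :: fpair" and ?w = "((\<lambda>x. 0), \<tau>) :: fpair"
    have "bracket ?v ?w = ((\<lambda>x. 0), (\<lambda>x. 0))"
      by (simp add: bracket_def)
    then have "translate (bracket ?v (D ?w)) (- 1) (bracket ?w (D ?v)) = ((\<lambda>x. 0), (\<lambda>x. 0))"
      using der[of ?v ?w] that gdual_linear_zero[OF D] by (simp add: circle_smooth_const)
    then show ?thesis
      by (auto simp: P_def translate_def bracket_def split_beta fun_eq_iff)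
  qed
  have leibniz: "P (\<lambda>x. u x * deriv \<rho> x) = (\<lambda>x. u x * deriv (P \<rho>) x - deriv u x * P \<rho> x)"
    if "u \<in> circle_smooth" "\<rho> \<in> circle_smooth" for u \<rho>
  proof -
    let ?v = "(u, (\<lambda>x. 0)) :: fpair" and ?w = "((\<lambda>x. 0), \<rho>) :: fpair"
    have "bracket ?v ?w = ((\<lambda>x. 0), (\<lambda>x. u x * deriv \<rho> x))"
      by (simp add: bracket_def)
    then show ?thesis
      using der[of ?v ?w] that
      by (simp add: P_def circle_smooth_const translate_def bracket_def split_beta)
  qed
  let ?y = "P sin"
  have y: "?y \<in> circle_smooth"
    by (intro P_smooth sin_circle_smooth)
  have y': "P cos = deriv ?y"
    using leibniz[OF circle_smooth_const[of 1] sin_circle_smooth] by (simp add: deriv_sin_fun)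
  note Dy = circle_smooth_DERIV[OF y] circle_smooth_DERIV[OF circle_smooth_deriv[OF y]]
  have first: "deriv ?y x * cos x = - (?y x * sin x)" for x
    using commute[OF sin_circle_smooth cos_circle_smooth, of x] y'
    by (simp add: deriv_sin_fun deriv_cos_fun)
  have second: "deriv (deriv ?y) x * cos x = - (?y x * cos x)" for x
  proof -
    have eq: "(\<lambda>x. deriv ?y x * cos x) = (\<lambda>x. - (?y x * sin x))"
      using first by auto
    have "((\<lambda>x. deriv ?y x * cos x) has_real_derivative
        deriv (deriv ?y) x * cos x - deriv ?y x * sin x) (at x)"
      by (rule Dy derivative_eq_intros refl)+ simp
    moreover have "((\<lambda>x. - (?y x * sin x)) has_real_derivative
        - (deriv ?y x * sin x + ?y x * cos x)) (at x)"
      by (rule Dy derivative_eq_intros refl)+ simp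
    ultimately show ?thesis
      unfolding eq using DERIV_unique by fastforce
  qed
  \<comment> \<open>Both sides are \<open>P\<close> of the same function, since \<open>sin * sin' = (- cos) * cos'\<close>.\<close>
  have third: "sin x * deriv ?y x - cos x * ?y x = - (cos x * deriv (deriv ?y) x) - sin x * deriv ?y x" for x
  proof -
    have "deriv (\<lambda>x::real. - cos x) = sin"
      by (rule ext, rule DERIV_imp_deriv) (auto intro!: derivative_eq_intros)
    then have "P (\<lambda>x. sin x * cos x) = (\<lambda>x. - (cos x * deriv (deriv ?y) x) - sin x * deriv ?y x)"
      using leibniz[OF circle_smooth_uminus[OF cos_circle_smooth] cos_circle_smooth]
      by (simp add: deriv_cos_fun y' mult.commute)
    moreover have "P (\<lambda>x. sin x * cos x) = (\<lambda>x. sin x * deriv ?y x - cos x * ?y x)"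
      using leibniz[OF sin_circle_smooth sin_circle_smooth] by (simp add: deriv_sin_fun)
    ultimately have "(\<lambda>x. sin x * deriv ?y x - cos x * ?y x) =
        (\<lambda>x. - (cos x * deriv (deriv ?y) x) - sin x * deriv ?y x)"
      by simp
    from fun_cong[OF this, of x] show ?thesis .
  qed
  have y0: "?y x = 0" for x
  proof -
    have "sin x * deriv ?y x = cos x * ?y x"
      using third[of x] second[of x] by (simp add: mult.commute)
    then have "?y x * ((sin x)\<^sup>2 + (cos x)\<^sup>2) = 0"
      using first[of x] by algebra
    then show ?thesis by simp
  qed
  have "P \<sigma> x = 0" for x
  proof -
    have "P cos x = 0"
    proof -
      have "?y = (\<lambda>x. 0)" using y0 by auto
      then show ?thesis unfolding y' by simp
    qed
    then have "P \<sigma> x * sin x = 0" "P \<sigma> x * cos x = 0"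
      using commute[OF \<sigma> cos_circle_smooth, of x] commute[OF \<sigma> sin_circle_smooth, of x] y0
      by (simp_all add: deriv_sin_fun deriv_cos_fun)
    moreover have "sin x \<noteq> 0 \<or> cos x \<noteq> 0"
      using sin_cos_squared_add[of x] by fastforce
    ultimately show ?thesis by auto
  qed
  then show ?thesis by (auto simp: P_def)
qed

text \<open>
  Once \<open>D\<close> is \<open>c \<partial>\<close> on the second factor, the Leibniz rule for the bracket of \<open>(u, 0)\<close> and \<open>(0, \<rho>)\<close>, which is
  \<open>(0, u \<rho>')\<close>, leaves only \<open>c \<partial>\<close> on the first factor, up to a contribution to the second component.
\<close>

lemma derivation_on_first_factor:
  assumes D: "gdual_linear D"
    and der: "\<And>v w. v \<in> gdual \<Longrightarrow> w \<in> gdual \<Longrightarrow>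
      D (bracket v w) = translate (bracket v (D w)) (- 1) (bracket w (D v))"
    and second: "\<And>\<rho>. \<rho> \<in> circle_smooth \<Longrightarrow> D ((\<lambda>x. 0), \<rho>) = ((\<lambda>x. 0), (\<lambda>x. c * deriv \<rho> x))"
    and u: "u \<in> circle_smooth"
  shows "fst (D (u, (\<lambda>x. 0))) = (\<lambda>x. c * deriv u x)"
proof
  fix x
  let ?v = "(u, (\<lambda>x. 0)) :: fpair"
  have *: "fst (D ?v) x * deriv \<rho> x = c * deriv u x * deriv \<rho> x" if \<rho>: "\<rho> \<in> circle_smooth" for \<rho>
  proof -
    let ?w = "((\<lambda>x. 0), \<rho>) :: fpair"
    note Ds = circle_smooth_DERIV[OF u] circle_smooth_DERIV[OF circle_smooth_deriv[OF \<rho>]]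
    have "bracket ?v ?w = ((\<lambda>x. 0), (\<lambda>x. u x * deriv \<rho> x))"
      by (simp add: bracket_def)
    moreover have "(\<lambda>x. u x * deriv \<rho> x) \<in> circle_smooth"
      by (intro circle_smooth_intros u \<rho>)
    ultimately have eq: "(\<lambda>x. c * deriv (\<lambda>x. u x * deriv \<rho> x) x) =
        (\<lambda>x. u x * deriv (\<lambda>x. c * deriv \<rho> x) x + fst (D ?v) x * deriv \<rho> x)"
      using der[of ?v ?w] u \<rho> second[of "\<lambda>x. u x * deriv \<rho> x"] second[OF \<rho>]
      by (simp add: circle_smooth_const translate_def bracket_def split_beta)
    have "deriv (\<lambda>x. u x * deriv \<rho> x) x = deriv u x * deriv \<rho> x + u x * deriv (deriv \<rho>) x"
      by (rule DERIV_imp_deriv) (rule Ds derivative_eq_intros refl | simp)+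
    moreover have "deriv (\<lambda>x. c * deriv \<rho> x) x = c * deriv (deriv \<rho>) x"
      by (rule DERIV_imp_deriv) (rule Ds derivative_eq_intros refl | simp)+
    ultimately show ?thesis
      using fun_cong[OF eq, of x] by (auto simp: algebra_simps)
  qed
  have "fst (D ?v) x * sin x = c * deriv u x * sin x" "fst (D ?v) x * cos x = c * deriv u x * cos x"
    using *[OF cos_circle_smooth] *[OF sin_circle_smooth] by (simp_all add: deriv_sin_fun deriv_cos_fun)
  moreover have "sin x \<noteq> 0 \<or> cos x \<noteq> 0"
    using sin_cos_squared_add[of x] by fastforce
  ultimately show "fst (D ?v) x = c * deriv u x" by auto
qed

text \<open>
  The case distinction covers an upper bound \<open>n = 0\<close>, for which the coefficient \<open>b 1\<close> is absent from the
  sum and has to be read as zero.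
\<close>

lemma sum_first_two:
  fixes b f :: "nat \<Rightarrow> real"
  assumes "\<And>i. 2 \<le> i \<Longrightarrow> i \<le> n \<Longrightarrow> b i = 0"
  shows "(\<Sum>i=0..n. b i * f i) = b 0 * f 0 + (if n \<ge> 1 then b 1 else 0) * f 1"
proof (cases "n \<ge> 1")
  case True
  then have "(\<Sum>i=0..n. b i * f i) = (\<Sum>i\<in>{0, 1}. b i * f i)"
    using assms by (intro sum.mono_neutral_right) (auto simp: not_le)
  with True show ?thesis by simp
next
  case False
  then have "n = 0" by simp
  then show ?thesis by simp
qed

text \<open>
  The derivation \<open>D\<close> acts as \<open>D (0, \<rho>) = (0, c \<rho>')\<close> and \<open>D (u, 0) = (c u', S u)\<close>, and the entries of \<open>M D = J\<close>
  can be read off. The upper right one makes \<open>c\<close> times the off-diagonal entry of \<open>M\<close>, composed with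
  \<open>\<partial>\<close>, equal to \<open>p\<^sub>0 \<partial> + c\<^sub>2 \<partial>\<^sup>2\<close>; the lower left one then gives \<open>S = 0\<close>, and the upper left one bounds the order of
  the remaining entry of \<open>M\<close>. All of this requires \<open>c \<noteq> 0\<close>: otherwise \<open>J\<close> and hence the Euler field would vanish.
\<close>

theorem bihamiltonian_imp_special:
  fixes n\<^sub>0 n\<^sub>1 :: nat and a b :: "nat \<Rightarrow> real" and \<gamma> \<epsilon> m\<^sub>0 p\<^sub>0 c\<^sub>1 c\<^sub>2 c\<^sub>3 :: real
  defines "M \<equiv> inertia_operator n\<^sub>0 n\<^sub>1 a b \<gamma> \<epsilon>"
    and "J \<equiv> modified_lie_poisson m\<^sub>0 p\<^sub>0 c\<^sub>1 c\<^sub>2 c\<^sub>3"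
  assumes pos: "strictly_positive M" and bij: "bij_betw M gdual gdual"
    and diff: "L2_differentiable H"
    and ham: "\<And>\<mu>. \<mu> \<in> gdual \<Longrightarrow> euler_field M \<mu> = J (L2_gradient H \<mu>)"
  shows "\<exists>\<alpha> \<beta>. \<forall>w\<in>gdual. M w = special_inertia_operator \<alpha> \<beta> \<gamma> \<epsilon> w"
proof -
  have M_lin: "gdual_linear M" and J_lin: "gdual_linear J"
    by (simp_all add: M_def J_def inertia_operator_linear modified_lie_poisson_linear)
  have sym: "pairing (M v) w = pairing v (M w)" if "v \<in> gdual" "w \<in> gdual" for v w
    unfolding M_def by (rule inertia_operator_symmetric[OF that])
  have \<gamma>: "\<gamma> > 0"
    using pos unfolding M_def by (rule inertia_operator_gamma_pos)
  define D where "D = (\<lambda>v. inv_into gdual M (J v))"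
  have D_lin: "gdual_linear D"
    unfolding D_def by (rule gdual_linear_compose[OF gdual_linear_inv[OF M_lin bij] J_lin])
  have MD: "M (D v) = J v" if "v \<in> gdual" for v
    unfolding D_def using bij gdual_linear_mem[OF J_lin that] by (rule bij_betw_inv_into_right)
  have grad: "has_L2_gradient H \<mu> (L2_gradient H \<mu>)" if "\<mu> \<in> gdual" for \<mu>
    using diff that L2_gradient_eqI unfolding L2_differentiable_def by metis
  have ham': "lie_poisson (M w) w = J (L2_gradient H (M w))" if "w \<in> gdual" for w
    using ham[OF gdual_linear_mem[OF M_lin that]] euler_field_eq[OF M_lin bij sym that] by simp
  have der: "D (bracket v w) = translate (bracket v (D w)) (- 1) (bracket w (D v))"
    if "v \<in> gdual" "w \<in> gdual" for v w
  proof (rule recursion_operator_derivation[OF M_lin _ sym _ grad _ that])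
    show "\<exists>w\<in>gdual. M w = \<mu>" if "\<mu> \<in> gdual" for \<mu>
      using bij that unfolding bij_betw_def by (metis imageE)
    show "D v \<in> gdual \<and> M (D v) = modified_lie_poisson m\<^sub>0 p\<^sub>0 c\<^sub>1 c\<^sub>2 c\<^sub>3 v" if "v \<in> gdual" for v
      using MD[OF that] gdual_linear_mem[OF D_lin that] by (simp add: J_def)
    show "lie_poisson (M w) w = modified_lie_poisson m\<^sub>0 p\<^sub>0 c\<^sub>1 c\<^sub>2 c\<^sub>3 (L2_gradient H (M w))"
      if "w \<in> gdual" for w
      using ham'[OF that] by (simp add: J_def)
  qed

  define c where "c = 2 * c\<^sub>3 / \<gamma>"
  have D_second: "D ((\<lambda>x. 0), \<rho>) = ((\<lambda>x. 0), (\<lambda>x. c * deriv \<rho> x))"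
    and J12: "(\<Sum>i=0..n\<^sub>1. (-1) ^ i * b i * (c * (deriv ^^ i) (deriv \<rho>) x)) = p\<^sub>0 * deriv \<rho> x + c\<^sub>2 * deriv (deriv \<rho>) x"
    if \<rho>: "\<rho> \<in> circle_smooth" for \<rho> x
  proof -
    obtain q where Dq: "D ((\<lambda>x. 0), \<rho>) = ((\<lambda>x. 0), q)"
      using derivation_on_second_factor[OF D_lin der \<rho>] by (metis prod.collapse)
    have "M ((\<lambda>x. 0), q) = J ((\<lambda>x. 0), \<rho>)"
      using MD[of "((\<lambda>x. 0), \<rho>)"] \<rho> Dq by (simp add: circle_smooth_const)
    then have eqs: "(\<Sum>i=0..n\<^sub>1. (-1) ^ i * b i * (deriv ^^ i) q x) = p\<^sub>0 * deriv \<rho> x + c\<^sub>2 * deriv (deriv \<rho>) x"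
      "\<gamma> * q x = 2 * c\<^sub>3 * deriv \<rho> x" for x
      by (auto simp: M_def J_def inertia_operator_def modified_lie_poisson_def iterated_deriv_zero
          fun_eq_iff deriv_pow_2)
    have q: "q = (\<lambda>x. c * deriv \<rho> x)"
      using eqs(2) \<gamma> by (auto simp: c_def field_simps)
    with Dq show "D ((\<lambda>x. 0), \<rho>) = ((\<lambda>x. 0), (\<lambda>x. c * deriv \<rho> x))" by simp
    show "(\<Sum>i=0..n\<^sub>1. (-1) ^ i * b i * (c * (deriv ^^ i) (deriv \<rho>) x)) = p\<^sub>0 * deriv \<rho> x + c\<^sub>2 * deriv (deriv \<rho>) x"
      using eqs(1)[of x] unfolding q iterated_deriv_cmult[OF circle_smooth_deriv[OF \<rho>]] .
  qed
  define S where "S u = snd (D (u, (\<lambda>x. 0)))" for u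
  have D_first: "D (u, (\<lambda>x. 0)) = ((\<lambda>x. c * deriv u x), S u)" if "u \<in> circle_smooth" for u
    using derivation_on_first_factor[OF D_lin der D_second that] by (simp add: S_def prod_eq_iff)
  have J11: "\<epsilon> * (c * deriv u x - c * deriv (deriv (deriv u)) x)
        + (\<Sum>i=2..n\<^sub>0. a i * (c * (deriv ^^ (2 * i)) (deriv u) x))
        + (\<Sum>i=0..n\<^sub>1. (-1) ^ i * b i * (deriv ^^ i) (S u) x)
      = 2 * m\<^sub>0 * deriv u x - c\<^sub>1 * deriv (deriv (deriv u)) x"
    and J21: "(\<Sum>i=0..n\<^sub>1. b i * (c * (deriv ^^ i) (deriv u) x)) + \<gamma> * S u x
      = p\<^sub>0 * deriv u x - c\<^sub>2 * deriv (deriv u) x"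
    if u: "u \<in> circle_smooth" for u x
  proof -
    have "M ((\<lambda>x. c * deriv u x), S u) = J (u, (\<lambda>x. 0))"
      using MD[of "(u, (\<lambda>x. 0))"] u by (simp add: circle_smooth_const D_first)
    then show "\<epsilon> * (c * deriv u x - c * deriv (deriv (deriv u)) x)
        + (\<Sum>i=2..n\<^sub>0. a i * (c * (deriv ^^ (2 * i)) (deriv u) x))
        + (\<Sum>i=0..n\<^sub>1. (-1) ^ i * b i * (deriv ^^ i) (S u) x)
      = 2 * m\<^sub>0 * deriv u x - c\<^sub>1 * deriv (deriv (deriv u)) x"
      "(\<Sum>i=0..n\<^sub>1. b i * (c * (deriv ^^ i) (deriv u) x)) + \<gamma> * S u x
      = p\<^sub>0 * deriv u x - c\<^sub>2 * deriv (deriv u) x"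
      by (auto simp: M_def J_def inertia_operator_def modified_lie_poisson_def iterated_deriv_zero
          fun_eq_iff deriv_pow_3 deriv_pow_2 iterated_deriv_cmult circle_smooth_deriv u
          iterated_deriv_cmult[of "deriv u" 2 c, unfolded deriv_pow_2])
  qed

  have c: "c \<noteq> 0"
  proof
    assume c0: "c = 0"
    have "deriv (\<lambda>x::real. - sin x) 0 = - 1"
      by (rule DERIV_imp_deriv) (auto intro!: derivative_eq_intros)
    then have p0: "p\<^sub>0 = 0" and c2: "c\<^sub>2 = 0"
      using J12[OF sin_circle_smooth, of 0] J12[OF cos_circle_smooth, of 0] c0
      by (simp_all add: deriv_sin_fun deriv_cos_fun)
    have c3: "c\<^sub>3 = 0"
      using c0 \<gamma> by (simp add: c_def)
    have S0: "S u = (\<lambda>x. 0)" if "u \<in> circle_smooth" for u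
      using J21[OF that] c0 p0 c2 \<gamma> by auto
    have wave: "2 * m\<^sub>0 * deriv u 0 - c\<^sub>1 * deriv (deriv (deriv u)) 0 = 0"
      if "u \<in> circle_smooth" for u
      using J11[OF that, of 0] S0[OF that] c0 by (simp add: iterated_deriv_zero)
    \<comment> \<open>Frequencies \<open>1\<close> and \<open>2\<close> give two independent equations for \<open>m\<^sub>0\<close> and \<open>c\<^sub>1\<close>.\<close>
    have waves: "2 * m\<^sub>0 * real k + c\<^sub>1 * real k ^ 3 = 0" for k
    proof -
      let ?u = "\<lambda>x. sin (real k * x + 0)"
      have "?u \<in> circle_smooth"
        using sin_wave_circle_smooth[of 1 k 0] by simp
      moreover have "sin (3 * pi / 2) = - 1"
        using sin_3over2_pi by (simp add: field_simps)
      then have "deriv ?u 0 = real k" "deriv (deriv (deriv ?u)) 0 = - (real k ^ 3)"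
        using iterated_deriv_sin_wave[of 1 k 0] iterated_deriv_sin_wave[of 3 k 0]
        by (simp_all add: deriv_pow_3)
      ultimately show ?thesis using wave[of ?u] by simp
    qed
    have "m\<^sub>0 = 0" "c\<^sub>1 = 0"
      using waves[of 1] waves[of 2] by simp_all
    then have J0: "J v = ((\<lambda>x. 0), (\<lambda>x. 0))" for v
      using p0 c2 c3 by (cases v) (simp add: J_def modified_lie_poisson_def)
    \<comment> \<open>At \<open>M (0, sin)\<close> the first component of the Euler field is \<open>\<gamma> sin cos\<close>, which does not vanish at \<open>\<pi> / 4\<close>.\<close>
    have "fst (lie_poisson (M ((\<lambda>x. 0), sin)) ((\<lambda>x. 0), sin)) (pi / 4) = 0"
      using ham'[of "((\<lambda>x. 0), sin)"] J0 by (simp add: circle_smooth_const sin_circle_smooth)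
    then have "\<gamma> * sin (pi / 4) * cos (pi / 4) = 0"
      by (simp add: M_def inertia_operator_def lie_poisson_def iterated_deriv_zero deriv_sin_fun)
    then show False
      using \<gamma> by (simp add: sin_45 cos_45)
  qed

  \<comment> \<open>Padding by zeros gives access to the coefficient of index \<open>1\<close> even when \<open>n\<^sub>1 = 0\<close>.\<close>
  define b' where "b' i = (if i \<le> n\<^sub>1 then b i else 0)" for i
  \<comment> \<open>The coefficients in \<open>J12\<close> after bringing everything to one side.\<close>
  define e where "e i = (-1) ^ i * b' i * c - (if i = 0 then p\<^sub>0 else 0) - (if i = 1 then c\<^sub>2 else 0)" for i
  have e0: "e i = 0" if "i \<le> n\<^sub>1 + 1" for i
  proof (rule derivative_coefficients_vanish[where s = 1 and n = "n\<^sub>1 + 1"])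
    fix f assume f: "f \<in> circle_smooth"
    let ?d = "\<lambda>i. (deriv ^^ i) (deriv f) 0"
    have "(\<Sum>i\<le>n\<^sub>1 + 1. e i * (deriv ^^ (1 * i + 1)) f 0) =
        (\<Sum>i\<le>n\<^sub>1 + 1. (-1) ^ i * b' i * c * ?d i) - (\<Sum>i\<le>n\<^sub>1 + 1. (if i = 0 then p\<^sub>0 * ?d i else 0))
        - (\<Sum>i\<le>n\<^sub>1 + 1. (if i = 1 then c\<^sub>2 * ?d i else 0))"
      unfolding sum_subtractf[symmetric] e_def
      by (intro sum.cong) (auto simp: funpow_swap1 algebra_simps)
    also have "(\<Sum>i\<le>n\<^sub>1 + 1. (-1) ^ i * b' i * c * ?d i) = (\<Sum>i=0..n\<^sub>1. (-1) ^ i * b i * (c * ?d i))"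
      by (rule sum.mono_neutral_cong_right) (auto simp: b'_def)
    finally show "(\<Sum>i\<le>n\<^sub>1 + 1. e i * (deriv ^^ (1 * i + 1)) f 0) = 0"
      using J12[OF f, of 0] by (simp add: sum.delta)
  qed (use that in simp_all)
  have b0: "c * b' 0 = p\<^sub>0" and b1: "c * b' 1 = - c\<^sub>2"
    using e0[of 0] e0[of 1] by (simp_all add: e_def algebra_simps)
  have b_high: "b i = 0" if "2 \<le> i" "i \<le> n\<^sub>1" for i
    using e0[of i] that c by (simp add: e_def b'_def)
  have B: "(\<Sum>i=0..n\<^sub>1. b i * f i) = b' 0 * f 0 + b' 1 * f 1" for f
    using sum_first_two[of n\<^sub>1 b f] b_high by (simp add: b'_def)

  have S0: "S u = (\<lambda>x. 0)" if u: "u \<in> circle_smooth" for u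
  proof
    fix x
    have "\<gamma> * S u x = 0"
      using J21[OF u, of x] b0 b1 unfolding B by (simp add: algebra_simps) algebra
    with \<gamma> show "S u x = 0" by simp
  qed
  have a_high: "a i = 0" if i: "2 \<le> i" "i \<le> n\<^sub>0" for i
  proof -
    \<comment> \<open>The coefficients of \<open>\<partial>\<^sup>2\<^sup>i\<^sup>+\<^sup>1\<close> in \<open>J11\<close>, given that \<open>S u = 0\<close>.\<close>
    define e where "e i = (if i = 0 then c * \<epsilon> - 2 * m\<^sub>0 else if i = 1 then c\<^sub>1 - c * \<epsilon> else c * a i)" for i
    have "e i = 0"
    proof (rule derivative_coefficients_vanish[where s = 2 and n = n\<^sub>0])
      fix f assume f: "f \<in> circle_smooth"
      have "{..n\<^sub>0} = insert 0 (insert 1 {2..n\<^sub>0})"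
        using i by auto
      then have "(\<Sum>i\<le>n\<^sub>0. e i * (deriv ^^ (2 * i + 1)) f 0) =
          e 0 * deriv f 0 + e 1 * deriv (deriv (deriv f)) 0 + (\<Sum>i=2..n\<^sub>0. e i * (deriv ^^ (2 * i + 1)) f 0)"
        by (simp add: numeral_2_eq_2)
      also have "(\<Sum>i=2..n\<^sub>0. e i * (deriv ^^ (2 * i + 1)) f 0) =
          (\<Sum>i=2..n\<^sub>0. a i * (c * (deriv ^^ (2 * i)) (deriv f) 0))"
        by (intro sum.cong) (auto simp: e_def funpow_swap1)
      finally show "(\<Sum>i\<le>n\<^sub>0. e i * (deriv ^^ (2 * i + 1)) f 0) = 0"
        using J11[OF f, of 0] S0[OF f] by (simp add: e_def iterated_deriv_zero algebra_simps)
    qed (use i in simp_all)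
    then show ?thesis using i c by (simp add: e_def)
  qed

  have "M w = special_inertia_operator (b' 0) (b' 1) \<gamma> \<epsilon> w" if "w \<in> gdual" for w
  proof -
    have B_adj: "(\<Sum>i=0..n\<^sub>1. (-1) ^ i * b i * f i) = b' 0 * f 0 - b' 1 * f 1" for f
      using B[of "\<lambda>i. (-1) ^ i * f i"] by (simp add: ac_simps)
    show ?thesis
      using a_high
      by (cases w) (simp add: M_def inertia_operator_def special_inertia_operator_def B B_adj)
  qed
  then show ?thesis by blast
qed

section \<open>Continuity of the inverse of a special inertia operator\<close>

lemma deriv_special_inertia_operator:
  assumes "u \<in> circle_smooth" "\<rho> \<in> circle_smooth"
  shows "deriv (fst (special_inertia_operator \<alpha> \<beta> \<gamma> \<epsilon> (u, \<rho>))) =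
      fst (special_inertia_operator \<alpha> \<beta> \<gamma> \<epsilon> (deriv u, deriv \<rho>))"
    and "deriv (snd (special_inertia_operator \<alpha> \<beta> \<gamma> \<epsilon> (u, \<rho>))) =
      snd (special_inertia_operator \<alpha> \<beta> \<gamma> \<epsilon> (deriv u, deriv \<rho>))"
proof -
  note D = assms[THEN circle_smooth_DERIV] assms[THEN circle_smooth_deriv, THEN circle_smooth_DERIV]
    assms[THEN circle_smooth_deriv, THEN circle_smooth_deriv, THEN circle_smooth_DERIV]
  show "deriv (fst (special_inertia_operator \<alpha> \<beta> \<gamma> \<epsilon> (u, \<rho>))) =
      fst (special_inertia_operator \<alpha> \<beta> \<gamma> \<epsilon> (deriv u, deriv \<rho>))"
    unfolding special_inertia_operator_def prod.case fst_conv deriv_pow_2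
    by (rule ext, rule DERIV_imp_deriv) (rule D derivative_eq_intros refl | simp)+
  show "deriv (snd (special_inertia_operator \<alpha> \<beta> \<gamma> \<epsilon> (u, \<rho>))) =
      snd (special_inertia_operator \<alpha> \<beta> \<gamma> \<epsilon> (deriv u, deriv \<rho>))"
    unfolding special_inertia_operator_def prod.case snd_conv
    by (rule ext, rule DERIV_imp_deriv) (rule D derivative_eq_intros refl | simp)+
qed

lemma iterated_deriv_special_inertia_operator:
  assumes "u \<in> circle_smooth" "\<rho> \<in> circle_smooth"
  shows "(deriv ^^ k) (fst (special_inertia_operator \<alpha> \<beta> \<gamma> \<epsilon> (u, \<rho>))) =
      fst (special_inertia_operator \<alpha> \<beta> \<gamma> \<epsilon> ((deriv ^^ k) u, (deriv ^^ k) \<rho>))"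
    and "(deriv ^^ k) (snd (special_inertia_operator \<alpha> \<beta> \<gamma> \<epsilon> (u, \<rho>))) =
      snd (special_inertia_operator \<alpha> \<beta> \<gamma> \<epsilon> ((deriv ^^ k) u, (deriv ^^ k) \<rho>))"
  by (induction k)
     (simp_all add: deriv_special_inertia_operator circle_smooth_iterated_deriv assms)

lemma special_inertia_operator_as_inertia_operator:
  "special_inertia_operator \<alpha> \<beta> \<gamma> \<epsilon> =
     inertia_operator 1 1 (\<lambda>i. 0) (\<lambda>i. if i = 0 then \<alpha> else \<beta>) \<gamma> \<epsilon>"
  by (simp add: special_inertia_operator_def inertia_operator_def fun_eq_iff)

text \<open>
  Elimination of \<open>\<rho>\<close> by means of the second component leaves a scalar equation for \<open>u\<close>: the two first-order terms
  \<open>\<alpha>\<beta> u' / \<gamma>\<close> cancel, and the Schur complement \<open>(\<epsilon> - \<alpha>\<^sup>2 / \<gamma>) - (\<epsilon> - \<beta>\<^sup>2 / \<gamma>) \<partial>\<^sup>2\<close> remains.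
\<close>

lemma special_inertia_operator_schur:
  fixes \<alpha> \<beta> \<gamma> \<epsilon> :: real and u \<rho> :: "real \<Rightarrow> real"
  assumes "\<gamma> \<noteq> 0"
  defines "m \<equiv> fst (special_inertia_operator \<alpha> \<beta> \<gamma> \<epsilon> (u, \<rho>))"
    and "p \<equiv> snd (special_inertia_operator \<alpha> \<beta> \<gamma> \<epsilon> (u, \<rho>))"
  assumes u: "u \<in> circle_smooth" and \<rho>: "\<rho> \<in> circle_smooth"
  shows "(\<epsilon> - \<alpha>\<^sup>2 / \<gamma>) * u x - (\<epsilon> - \<beta>\<^sup>2 / \<gamma>) * deriv (deriv u) x =
      m x - (\<alpha> / \<gamma>) * p x + (\<beta> / \<gamma>) * deriv p x"
    and "\<rho> x = (1 / \<gamma>) * p x - (\<alpha> / \<gamma>) * u x - (\<beta> / \<gamma>) * deriv u x"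
proof -
  have p': "deriv p x = \<alpha> * deriv u x + \<beta> * deriv (deriv u) x + \<gamma> * deriv \<rho> x"
    using deriv_special_inertia_operator(2)[OF u \<rho>]
    by (simp add: p_def special_inertia_operator_def)
  show "(\<epsilon> - \<alpha>\<^sup>2 / \<gamma>) * u x - (\<epsilon> - \<beta>\<^sup>2 / \<gamma>) * deriv (deriv u) x =
      m x - (\<alpha> / \<gamma>) * p x + (\<beta> / \<gamma>) * deriv p x"
    unfolding p' using \<open>\<gamma> \<noteq> 0\<close>
    by (simp add: m_def p_def special_inertia_operator_def deriv_pow_2 field_simps power2_eq_square)
  show "\<rho> x = (1 / \<gamma>) * p x - (\<alpha> / \<gamma>) * u x - (\<beta> / \<gamma>) * deriv u x"
    using \<open>\<gamma> \<noteq> 0\<close> by (simp add: p_def special_inertia_operator_def field_simps)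
qed

text \<open>
  Strict positivity passes to the Schur complement, whose symbol at frequency \<open>k\<close> is \<open>a + b k\<^sup>2\<close> with
  \<open>a = \<epsilon> - \<alpha>\<^sup>2 / \<gamma>\<close> and \<open>b = \<epsilon> - \<beta>\<^sup>2 / \<gamma>\<close>. Frequency \<open>0\<close> gives \<open>a > 0\<close> and large frequencies give
  \<open>b \<ge> 0\<close>. The value \<open>b = 0\<close> is possible: the equation for \<open>u\<close> is then algebraic.
\<close>

lemma special_inertia_operator_coercive:
  assumes "strictly_positive (special_inertia_operator \<alpha> \<beta> \<gamma> \<epsilon>)"
  shows "\<gamma> > 0" "\<epsilon> - \<alpha>\<^sup>2 / \<gamma> > 0" "\<epsilon> - \<beta>\<^sup>2 / \<gamma> \<ge> 0"
proof -
  let ?M = "special_inertia_operator \<alpha> \<beta> \<gamma> \<epsilon>"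
  let ?a = "\<epsilon> - \<alpha>\<^sup>2 / \<gamma>" and ?b = "\<epsilon> - \<beta>\<^sup>2 / \<gamma>"
  show \<gamma>: "\<gamma> > 0"
    using assms unfolding special_inertia_operator_as_inertia_operator
    by (rule inertia_operator_gamma_pos)
  have symbol: "?a + ?b * (real k)\<^sup>2 > 0" for k
  proof -
    define u where "u = (\<lambda>x. sin (real k * x + pi / 2))"
    \<comment> \<open>For given \<open>u\<close> this \<open>\<rho>\<close> annihilates the second component of \<open>M (u, \<rho>)\<close>.\<close>
    define \<rho> where "\<rho> = (\<lambda>x. - (\<alpha> * u x + \<beta> * deriv u x) / \<gamma>)"
    have u: "u \<in> circle_smooth"
      unfolding u_def using sin_wave_circle_smooth[of 1 k "pi / 2"] by simp
    have \<rho>: "\<rho> \<in> circle_smooth"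
      unfolding \<rho>_def by (intro circle_smooth_intros u)
    have u'': "deriv (deriv u) x = - ((real k)\<^sup>2 * u x)" for x
    proof -
      have "deriv (deriv u) x = (real k)\<^sup>2 * sin ((real k * x + pi / 2) + pi)"
        unfolding u_def deriv_pow_2[symmetric] iterated_deriv_sin_wave
        by (intro arg_cong[where f = "\<lambda>y. (real k)\<^sup>2 * sin y"]) simp
      then show ?thesis by (simp only: sin_periodic_pi u_def mult_minus_right)
    qed
    have p: "snd (?M (u, \<rho>)) = (\<lambda>x. 0)"
      using \<gamma> by (simp add: special_inertia_operator_def \<rho>_def)
    have m: "fst (?M (u, \<rho>)) x = (?a + ?b * (real k)\<^sup>2) * u x" for x
      using special_inertia_operator_schur(1)[where \<alpha> = \<alpha> and \<beta> = \<beta> and \<gamma> = \<gamma> and \<epsilon> = \<epsilon> and u = u and \<rho> = \<rho> and x = x] \<gamma> u \<rho> p u''[of x]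
      by (simp add: algebra_simps)
    have "(u, \<rho>) \<noteq> ((\<lambda>x. 0), (\<lambda>x. 0))"
      by (auto simp: u_def fun_eq_iff intro!: exI[of _ 0])
    then have "0 < pairing (u, \<rho>) (?M (u, \<rho>))"
      using assms u \<rho> unfolding strictly_positive_def by simp
    also have "\<dots> = (?a + ?b * (real k)\<^sup>2) * integral {0..2 * pi} (\<lambda>x. (u x)\<^sup>2)"
      unfolding integral_mult_right[symmetric]
      by (simp add: pairing_def m p power2_eq_square ac_simps)
    finally have "0 < (?a + ?b * (real k)\<^sup>2) * integral {0..2 * pi} (\<lambda>x. (u x)\<^sup>2)" .
    moreover have "integral {0..2 * pi} (\<lambda>x. (u x)\<^sup>2) \<ge> 0"
      by (intro integral_nonneg circle_smooth_integrable circle_smooth_intros u) simp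
    ultimately show ?thesis
      by (simp add: zero_less_mult_iff)
  qed
  show "?a > 0"
    using symbol[of 0] by simp
  show "?b \<ge> 0"
  proof (rule ccontr)
    assume "\<not> ?b \<ge> 0"
    then have b: "?b < 0" by simp
    obtain k :: nat where k: "?a / (- ?b) < real k"
      using reals_Archimedean2 by blast
    have "real k \<le> (real k)\<^sup>2"
      by (cases k) (auto simp: power2_eq_square)
    with k have "?a / (- ?b) < (real k)\<^sup>2" by linarith
    then have "?a < (- ?b) * (real k)\<^sup>2"
      using b by (simp add: pos_divide_less_eq mult.commute)
    then show False
      using symbol[of k] by (simp add: algebra_simps)
  qed
qed

lemma second_deriv_nonpos_at_max:
  assumes f: "f \<in> circle_smooth" and max: "\<And>y. f y \<le> f x"
  shows "deriv (deriv f) x \<le> 0"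
proof (rule ccontr)
  assume "\<not> deriv (deriv f) x \<le> 0"
  then obtain d where d: "d > 0" "\<And>h. 0 < h \<Longrightarrow> h < d \<Longrightarrow> deriv f x < deriv f (x + h)"
    using DERIV_pos_inc_right[OF circle_smooth_DERIV[OF circle_smooth_deriv[OF f]], of x] by auto
  have f'0: "deriv f x = 0"
    using DERIV_local_max[OF circle_smooth_DERIV[OF f], of 1 x] max by simp
  obtain z where z: "x < z" "z < x + d / 2" "f (x + d / 2) - f x = (x + d / 2 - x) * deriv f z"
    using MVT2[of x "x + d / 2" f "deriv f"] circle_smooth_DERIV[OF f] d(1) by auto
  have "deriv f z > 0"
    using d(2)[of "z - x"] z(1,2) d(1) f'0 by simp
  then have "(x + d / 2 - x) * deriv f z > 0"
    using d(1) by simp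
  then show False
    using max[of "x + d / 2"] z(3) by simp
qed

text \<open>
  At a maximum of \<open>u\<close> the term \<open>- b u''\<close> is nonnegative, so the bound there is a bound for \<open>a u\<close>.
\<close>

lemma maximum_principle:
  assumes a: "a > 0" and b: "b \<ge> 0" and u: "u \<in> circle_smooth"
    and bound: "\<And>x. a * u x - b * deriv (deriv u) x \<le> C"
  shows "a * u y \<le> C"
proof -
  obtain x where x: "\<And>y. u y \<le> u x"
    using circle_smooth_attains_max[OF u] by blast
  have "a * u y \<le> a * u x"
    using a x by simp
  also have "\<dots> \<le> a * u x - b * deriv (deriv u) x"
    using b second_deriv_nonpos_at_max[OF u x] by (simp add: mult_nonneg_nonpos)
  also have "\<dots> \<le> C" by (rule bound)
  finally show ?thesis .
qed

lemma elliptic_bound: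
  assumes a: "a > 0" and b: "b \<ge> 0" and u: "u \<in> circle_smooth"
    and bound: "\<And>x. \<bar>a * u x - b * deriv (deriv u) x\<bar> \<le> C"
  shows "\<bar>u y\<bar> \<le> C / a"
proof -
  have neg: "deriv (deriv (\<lambda>x. - u x)) = (\<lambda>x. - deriv (deriv u) x)"
    using iterated_deriv_cmult[OF u, of 2 "- 1"] by (simp add: deriv_pow_2)
  have "a * u y \<le> C"
    using bound by (intro maximum_principle[OF a b u]) (meson abs_le_D1)
  moreover have "a * - u y \<le> C"
  proof (rule maximum_principle[OF a b circle_smooth_uminus[OF u]])
    show "a * - u x - b * deriv (deriv (\<lambda>x. - u x)) x \<le> C" for x
      using bound[of x] unfolding neg by (simp add: abs_le_iff)
  qed
  ultimately show ?thesis
    using a by (simp add: abs_le_iff field_simps)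
qed

lemma uniform_limit_cmult:
  fixes f :: "nat \<Rightarrow> real \<Rightarrow> real"
  shows "uniform_limit X f l F \<Longrightarrow> uniform_limit X (\<lambda>n x. c * f n x) (\<lambda>x. c * l x) F"
  by (rule bounded_linear.uniform_limit[OF bounded_linear_mult_right])

text \<open>
  Continuity of \<open>inv M\<close> in the \<open>C\<^sup>\<infinity>\<close> topology. Derivatives commute with \<open>M\<close>, so each derivative of \<open>u\<close> solves
  the scalar equation with the differentiated right-hand side and is controlled by the maximum
  principle in the uniform norm; then \<open>\<rho>\<close> is recovered from the second component.
\<close>

lemma special_inverse_continuous:
  fixes \<alpha> \<beta> \<gamma> \<epsilon> :: real
  defines "M \<equiv> special_inertia_operator \<alpha> \<beta> \<gamma> \<epsilon>"
  assumes pos: "strictly_positive M"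
    and ws: "\<And>n. ws n \<in> gdual" and w: "w \<in> gdual"
    and lim: "Cinf_tendsto (\<lambda>n. M (ws n)) (M w)"
  shows "Cinf_tendsto ws w"
proof -
  note coercive = special_inertia_operator_coercive[OF pos[unfolded M_def]]
  let ?a = "\<epsilon> - \<alpha>\<^sup>2 / \<gamma>" and ?b = "\<epsilon> - \<beta>\<^sup>2 / \<gamma>"
  let ?h = "\<lambda>k w x. (deriv ^^ k) (fst (M w)) x - (\<alpha> / \<gamma>) * (deriv ^^ k) (snd (M w)) x
      + (\<beta> / \<gamma>) * (deriv ^^ Suc k) (snd (M w)) x"
  have schur: "?a * (deriv ^^ k) (fst w) x - ?b * (deriv ^^ Suc (Suc k)) (fst w) x = ?h k w x"
    and second: "(deriv ^^ k) (snd w) x = (1 / \<gamma>) * (deriv ^^ k) (snd (M w)) x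
      - (\<alpha> / \<gamma>) * (deriv ^^ k) (fst w) x - (\<beta> / \<gamma>) * (deriv ^^ Suc k) (fst w) x"
    if w: "w \<in> gdual" for w k x
  proof -
    obtain u \<rho> where w: "w = (u, \<rho>)" "u \<in> circle_smooth" "\<rho> \<in> circle_smooth"
      using \<open>w \<in> gdual\<close> by (elim gdual_cases) blast
    note s = special_inertia_operator_schur[where \<alpha> = \<alpha> and \<beta> = \<beta> and \<gamma> = \<gamma> and \<epsilon> = \<epsilon> and x = x,
        OF _ circle_smooth_iterated_deriv[OF w(2), of k]
        circle_smooth_iterated_deriv[OF w(3), of k],
        folded iterated_deriv_special_inertia_operator[OF w(2,3)]]
    show "?a * (deriv ^^ k) (fst w) x - ?b * (deriv ^^ Suc (Suc k)) (fst w) x = ?h k w x"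
      using s(1) coercive(1) by (simp add: w(1) M_def)
    show "(deriv ^^ k) (snd w) x = (1 / \<gamma>) * (deriv ^^ k) (snd (M w)) x
      - (\<alpha> / \<gamma>) * (deriv ^^ k) (fst w) x - (\<beta> / \<gamma>) * (deriv ^^ Suc k) (fst w) x"
      using s(2) coercive(1) by (simp add: w(1) M_def)
  qed
  have lim_fst: "uniform_limit UNIV (\<lambda>n. (deriv ^^ k) (fst (M (ws n)))) ((deriv ^^ k) (fst (M w))) sequentially"
    and lim_snd: "uniform_limit UNIV (\<lambda>n. (deriv ^^ k) (snd (M (ws n)))) ((deriv ^^ k) (snd (M w))) sequentially"
    for k
    using lim unfolding Cinf_tendsto_def by blast+
  have u_lim: "uniform_limit UNIV (\<lambda>n. (deriv ^^ k) (fst (ws n))) ((deriv ^^ k) (fst w)) sequentially" for k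
    unfolding uniform_limit_iff
  proof (intro allI impI)
    fix e :: real assume e: "e > 0"
    have "uniform_limit UNIV (\<lambda>n. ?h k (ws n)) (?h k w) sequentially"
      by (intro uniform_limit_add uniform_limit_minus uniform_limit_cmult lim_fst lim_snd)
    moreover have "?a * (e / 2) > 0"
      using coercive(2) e by simp
    ultimately have "\<forall>\<^sub>F n in sequentially. \<forall>x\<in>UNIV. dist (?h k (ws n) x) (?h k w x) < ?a * (e / 2)"
      unfolding uniform_limit_iff by blast
    then show "\<forall>\<^sub>F n in sequentially. \<forall>x\<in>UNIV. dist ((deriv ^^ k) (fst (ws n)) x) ((deriv ^^ k) (fst w) x) < e"
    proof eventually_elim
      case (elim n)
      let ?v = "\<lambda>x. (deriv ^^ k) (fst (ws n)) x + (- 1) * (deriv ^^ k) (fst w) x"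
      have smooth: "(deriv ^^ k) (fst (ws n)) \<in> circle_smooth" "(deriv ^^ k) (fst w) \<in> circle_smooth"
        by (intro circle_smooth_iterated_deriv gdual_fst ws w)+
      have v'': "deriv (deriv ?v) x = (deriv ^^ Suc (Suc k)) (fst (ws n)) x - (deriv ^^ Suc (Suc k)) (fst w) x" for x
        using iterated_deriv_lin[OF smooth, of 2 "- 1"] by (simp add: deriv_pow_2)
      have bound: "\<bar>?v x\<bar> \<le> ?a * (e / 2) / ?a" for x
      proof (rule elliptic_bound[OF coercive(2,3), where u = ?v])
        show "?v \<in> circle_smooth"
          by (intro circle_smooth_intros smooth)
        fix x
        have "?a * ?v x - ?b * deriv (deriv ?v) x = ?h k (ws n) x - ?h k w x"
          unfolding schur[OF ws, symmetric] schur[OF w, symmetric] v'' by (simp add: algebra_simps)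
        moreover have "\<bar>?h k (ws n) x - ?h k w x\<bar> < ?a * (e / 2)"
          using elim by (simp add: dist_real_def)
        ultimately show "\<bar>?a * ?v x - ?b * deriv (deriv ?v) x\<bar> \<le> ?a * (e / 2)"
          by linarith
      qed
      have "?a \<noteq> 0"
        using coercive(2) by simp
      from nonzero_mult_div_cancel_left[OF this, of "e / 2"] have "?a * (e / 2) / ?a < e"
        using e by linarith
      then show ?case
        using bound by (auto simp: dist_real_def intro: le_less_trans)
    qed
  qed
  have "uniform_limit UNIV (\<lambda>n. (deriv ^^ k) (snd (ws n))) ((deriv ^^ k) (snd w)) sequentially" for k
  proof -
    have "uniform_limit UNIV
        (\<lambda>n x. (1 / \<gamma>) * (deriv ^^ k) (snd (M (ws n))) x
          - (\<alpha> / \<gamma>) * (deriv ^^ k) (fst (ws n)) x - (\<beta> / \<gamma>) * (deriv ^^ Suc k) (fst (ws n)) x)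
        (\<lambda>x. (1 / \<gamma>) * (deriv ^^ k) (snd (M w)) x
          - (\<alpha> / \<gamma>) * (deriv ^^ k) (fst w) x - (\<beta> / \<gamma>) * (deriv ^^ Suc k) (fst w) x) sequentially"
      by (intro uniform_limit_minus uniform_limit_cmult lim_snd u_lim)
    then show ?thesis
      by (simp only: second[OF ws, symmetric] second[OF w, symmetric])
  qed
  with u_lim show ?thesis
    unfolding Cinf_tendsto_def by blast
qed

section \<open>The second Hamiltonian\<close>

lemma cubic_form_derivative:
  fixes T :: "fpair \<Rightarrow> fpair \<Rightarrow> fpair \<Rightarrow> real"
  assumes sym12: "\<And>a b c. T a b c = T b a c" and sym23: "\<And>a b c. T a b c = T a c b"
    and lin: "\<And>a a' b c t. a \<in> gdual \<Longrightarrow> a' \<in> gdual \<Longrightarrow> b \<in> gdual \<Longrightarrow> c \<in> gdual \<Longrightarrow>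
      T (translate a t a') b c = T a b c + t * T a' b c"
    and mem: "\<mu> \<in> gdual" "\<nu> \<in> gdual"
  shows "((\<lambda>t. T (translate \<mu> t \<nu>) (translate \<mu> t \<nu>) (translate \<mu> t \<nu>)) has_real_derivative
    3 * T \<nu> \<mu> \<mu>) (at 0)"
proof -
  have lin2: "T b (translate a t a') c = T b a c + t * T b a' c"
    and lin3: "T b c (translate a t a') = T b c a + t * T b c a'"
    if "a \<in> gdual" "a' \<in> gdual" "b \<in> gdual" "c \<in> gdual" for a a' b c t
    using lin[OF that] sym12 sym23 by metis+
  have "T (translate \<mu> t \<nu>) (translate \<mu> t \<nu>) (translate \<mu> t \<nu>) =
      T \<mu> \<mu> \<mu> + 3 * T \<nu> \<mu> \<mu> * t + 3 * T \<nu> \<nu> \<mu> * t ^ 2 + T \<nu> \<nu> \<nu> * t ^ 3" for t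
  proof -
    have "T \<mu> \<nu> \<mu> = T \<nu> \<mu> \<mu>" "T \<mu> \<mu> \<nu> = T \<nu> \<mu> \<mu>" "T \<nu> \<mu> \<nu> = T \<nu> \<nu> \<mu>" "T \<mu> \<nu> \<nu> = T \<nu> \<nu> \<mu>"
      using sym12 sym23 by metis+
    then show ?thesis
      using mem by (simp add: lin lin2 lin3 translate_gdual algebra_simps power2_eq_square power3_eq_cube)
  qed
  then show ?thesis
    by (auto intro!: derivative_eq_intros)
qed

text \<open>
  A cubic functional on a Frechet space is smooth as soon as its symmetric trilinear form is continuous: the
  iterated derivatives are polarizations of the form, and they vanish from order four on.
\<close>

lemma cubic_form_smooth:
  fixes T :: "fpair \<Rightarrow> fpair \<Rightarrow> fpair \<Rightarrow> real"
  assumes sym12: "\<And>a b c. T a b c = T b a c" and sym23: "\<And>a b c. T a b c = T a c b"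
    and lin: "\<And>a a' b c t. a \<in> gdual \<Longrightarrow> a' \<in> gdual \<Longrightarrow> b \<in> gdual \<Longrightarrow> c \<in> gdual \<Longrightarrow>
      T (translate a t a') b c = T a b c + t * T a' b c"
    and cont: "\<And>as bs cs a b c. \<forall>n. as n \<in> gdual \<Longrightarrow> \<forall>n. bs n \<in> gdual \<Longrightarrow> \<forall>n. cs n \<in> gdual \<Longrightarrow>
      a \<in> gdual \<Longrightarrow> b \<in> gdual \<Longrightarrow> c \<in> gdual \<Longrightarrow>
      Cinf_tendsto as a \<Longrightarrow> Cinf_tendsto bs b \<Longrightarrow> Cinf_tendsto cs c \<Longrightarrow>
      (\<lambda>n. T (as n) (bs n) (cs n)) \<longlonglongrightarrow> T a b c"
  shows "smooth_functional (\<lambda>\<mu>. T \<mu> \<mu> \<mu>)"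
proof -
  have lin2: "T b (translate a t a') c = T b a c + t * T b a' c"
    and lin3: "T b c (translate a t a') = T b c a + t * T b c a'"
    if "a \<in> gdual" "a' \<in> gdual" "b \<in> gdual" "c \<in> gdual" for a a' b c t
    using lin[OF that] sym12 sym23 by metis+
  define D where "D \<nu>s \<mu> =
    (if length \<nu>s = 0 then T \<mu> \<mu> \<mu>
     else if length \<nu>s = 1 then 3 * T (\<nu>s ! 0) \<mu> \<mu>
     else if length \<nu>s = 2 then 6 * T (\<nu>s ! 0) (\<nu>s ! 1) \<mu>
     else if length \<nu>s = 3 then 6 * T (\<nu>s ! 0) (\<nu>s ! 1) (\<nu>s ! 2)
     else 0)" for \<nu>s \<mu>
  have in_gdual: "\<nu>s ! i \<in> gdual" if "\<nu>s \<in> lists gdual" "i < length \<nu>s" for \<nu>s i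
    using that by (auto simp: in_lists_conv_set)
  have deriv: "((\<lambda>t. D \<nu>s (translate \<mu> t \<nu>)) has_real_derivative D (\<nu>s @ [\<nu>]) \<mu>) (at 0)"
    if \<nu>s: "\<nu>s \<in> lists gdual" and \<nu>: "\<nu> \<in> gdual" and \<mu>: "\<mu> \<in> gdual" for \<nu>s \<nu> \<mu>
  proof -
    consider "length \<nu>s = 0" | "length \<nu>s = 1" | "length \<nu>s = 2" | "length \<nu>s \<ge> 3"
      by linarith
    then show ?thesis
    proof cases
      case 1
      then show ?thesis
        using cubic_form_derivative[OF sym12 sym23 lin \<mu> \<nu>] by (simp add: D_def)
    next
      case 2
      let ?a = "\<nu>s ! 0"
      have a: "?a \<in> gdual" using in_gdual[OF \<nu>s] 2 by simp
      have "D \<nu>s (translate \<mu> t \<nu>) = 3 * T ?a \<mu> \<mu> + 6 * T ?a \<nu> \<mu> * t + 3 * T ?a \<nu> \<nu> * t ^ 2" for t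
        using 2 a \<mu> \<nu> sym23[of ?a \<mu> \<nu>]
        by (simp add: D_def lin2 lin3 translate_gdual algebra_simps power2_eq_square)
      moreover have "D (\<nu>s @ [\<nu>]) \<mu> = 6 * T ?a \<nu> \<mu>"
        using 2 by (simp add: D_def nth_append)
      ultimately show ?thesis
        by (auto intro!: derivative_eq_intros)
    next
      case 3
      let ?a = "\<nu>s ! 0" and ?b = "\<nu>s ! 1"
      have ab: "?a \<in> gdual" "?b \<in> gdual" using in_gdual[OF \<nu>s] 3 by simp_all
      have "D \<nu>s (translate \<mu> t \<nu>) = 6 * T ?a ?b \<mu> + 6 * T ?a ?b \<nu> * t" for t
        using 3 ab \<mu> \<nu> by (simp add: D_def lin3 algebra_simps)
      moreover have "D (\<nu>s @ [\<nu>]) \<mu> = 6 * T ?a ?b \<nu>"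
        using 3 by (simp add: D_def nth_append)
      ultimately show ?thesis
        by (auto intro!: derivative_eq_intros)
    next
      case 4
      then have "D \<nu>s (translate \<mu> t \<nu>) = D \<nu>s \<mu>" for t
        by (auto simp: D_def)
      moreover have "D (\<nu>s @ [\<nu>]) \<mu> = 0"
        using 4 by (auto simp: D_def)
      ultimately show ?thesis by simp
    qed
  qed
  have continuous: "(\<lambda>n. D (\<nu>ss n) (\<mu>s n)) \<longlonglongrightarrow> D \<nu>s \<mu>"
    if \<nu>s: "\<nu>s \<in> lists gdual" and \<mu>: "\<mu> \<in> gdual"
      and seq: "\<forall>n. \<nu>ss n \<in> lists gdual \<and> length (\<nu>ss n) = length \<nu>s \<and> \<mu>s n \<in> gdual"
      and \<mu>_lim: "Cinf_tendsto \<mu>s \<mu>"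
      and \<nu>_lim: "\<forall>i<length \<nu>s. Cinf_tendsto (\<lambda>n. \<nu>ss n ! i) (\<nu>s ! i)"
    for \<nu>ss \<nu>s \<mu>s \<mu>
  proof -
    have mem: "\<forall>n. \<mu>s n \<in> gdual" "\<And>i. i < length \<nu>s \<Longrightarrow> \<forall>n. \<nu>ss n ! i \<in> gdual"
      using seq in_gdual by auto
    have len: "length (\<nu>ss n) = length \<nu>s" for n
      using seq by blast
    consider "length \<nu>s = 0" | "length \<nu>s = 1" | "length \<nu>s = 2" | "length \<nu>s = 3" | "length \<nu>s > 3"
      by linarith
    then show ?thesis
    proof cases
      case 1
      then show ?thesis
        using cont[OF mem(1) mem(1) mem(1) \<mu> \<mu> \<mu> \<mu>_lim \<mu>_lim \<mu>_lim] by (simp add: D_def len)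
    next
      case 2
      then have l: "0 < length \<nu>s" by simp
      show ?thesis
        using 2 tendsto_mult_left[OF cont[OF mem(2)[OF l] mem(1) mem(1) in_gdual[OF \<nu>s l] \<mu> \<mu>
            \<nu>_lim[rule_format, OF l] \<mu>_lim \<mu>_lim], of 3]
        by (simp add: D_def len)
    next
      case 3
      then have l: "0 < length \<nu>s" "1 < length \<nu>s" by simp_all
      show ?thesis
        using 3 tendsto_mult_left[OF cont[OF mem(2)[OF l(1)] mem(2)[OF l(2)] mem(1)
            in_gdual[OF \<nu>s l(1)] in_gdual[OF \<nu>s l(2)] \<mu>
            \<nu>_lim[rule_format, OF l(1)] \<nu>_lim[rule_format, OF l(2)] \<mu>_lim], of 6]
        by (simp add: D_def len)
    next
      case 4
      then have l: "0 < length \<nu>s" "1 < length \<nu>s" "2 < length \<nu>s" by simp_all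
      show ?thesis
        using 4 tendsto_mult_left[OF cont[OF mem(2)[OF l(1)] mem(2)[OF l(2)] mem(2)[OF l(3)]
            in_gdual[OF \<nu>s l(1)] in_gdual[OF \<nu>s l(2)] in_gdual[OF \<nu>s l(3)]
            \<nu>_lim[rule_format, OF l(1)] \<nu>_lim[rule_format, OF l(2)] \<nu>_lim[rule_format, OF l(3)]], of 6]
        by (simp add: D_def len)
    next
      case 5
      then show ?thesis by (auto simp: D_def len)
    qed
  qed
  have "\<forall>\<mu>\<in>gdual. D [] \<mu> = T \<mu> \<mu> \<mu>"
    by (simp add: D_def)
  with deriv continuous show ?thesis
    unfolding smooth_functional_def by (intro exI[of _ D]) blast
qed

text \<open>
  The symmetric trilinear polarization of the cubic density
  \<open>\<epsilon> / 2 (u\<^sup>3 + u u'\<^sup>2) + \<alpha> u\<^sup>2 \<rho> + \<beta> u u' \<rho> + \<gamma> / 2 u \<rho>\<^sup>2\<close>, which is the density of the second Hamiltonian as a function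
  of \<open>w = (u, \<rho>)\<close>. Every term is a constant times a product of three functions.
\<close>

definition energy_density :: "real \<Rightarrow> real \<Rightarrow> real \<Rightarrow> real \<Rightarrow> fpair \<Rightarrow> fpair \<Rightarrow> fpair \<Rightarrow> real \<Rightarrow> real" where
  "energy_density \<alpha> \<beta> \<gamma> \<epsilon> = (\<lambda>(u, \<rho>) (v, \<sigma>) (w, \<tau>) x.
     \<epsilon> / 2 * (u x * v x * w x)
     + (\<epsilon> / 6 * (u x * deriv v x * deriv w x) + \<epsilon> / 6 * (deriv u x * v x * deriv w x)
        + \<epsilon> / 6 * (deriv u x * deriv v x * w x))
     + (\<alpha> / 3 * (u x * v x * \<tau> x) + \<alpha> / 3 * (u x * \<sigma> x * w x) + \<alpha> / 3 * (\<rho> x * v x * w x))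
     + (\<beta> / 6 * (u x * deriv v x * \<tau> x) + \<beta> / 6 * (deriv u x * v x * \<tau> x)
        + \<beta> / 6 * (u x * \<sigma> x * deriv w x) + \<beta> / 6 * (deriv u x * \<sigma> x * w x)
        + \<beta> / 6 * (\<rho> x * v x * deriv w x) + \<beta> / 6 * (\<rho> x * deriv v x * w x))
     + (\<gamma> / 6 * (u x * \<sigma> x * \<tau> x) + \<gamma> / 6 * (\<rho> x * v x * \<tau> x) + \<gamma> / 6 * (\<rho> x * \<sigma> x * w x)))"

definition energy_form :: "real \<Rightarrow> real \<Rightarrow> real \<Rightarrow> real \<Rightarrow> fpair \<Rightarrow> fpair \<Rightarrow> fpair \<Rightarrow> real" where
  "energy_form \<alpha> \<beta> \<gamma> \<epsilon> a b c = integral {0..2 * pi} (energy_density \<alpha> \<beta> \<gamma> \<epsilon> a b c)"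

lemma energy_density_smooth:
  assumes "a \<in> gdual" "b \<in> gdual" "c \<in> gdual"
  shows "energy_density \<alpha> \<beta> \<gamma> \<epsilon> a b c \<in> circle_smooth"
  using assms
  by (elim gdual_cases)
     (simp only: energy_density_def prod.case, intro circle_smooth_intros)

lemma energy_form_sym:
  "energy_form \<alpha> \<beta> \<gamma> \<epsilon> a b c = energy_form \<alpha> \<beta> \<gamma> \<epsilon> b a c"
  "energy_form \<alpha> \<beta> \<gamma> \<epsilon> a b c = energy_form \<alpha> \<beta> \<gamma> \<epsilon> a c b"
  by (cases a; cases b; cases c; simp add: energy_form_def energy_density_def ac_simps)+

lemma energy_form_linear:
  assumes mem: "a \<in> gdual" "a' \<in> gdual" "b \<in> gdual" "c \<in> gdual"
  shows "energy_form \<alpha> \<beta> \<gamma> \<epsilon> (translate a t a') b c =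
    energy_form \<alpha> \<beta> \<gamma> \<epsilon> a b c + t * energy_form \<alpha> \<beta> \<gamma> \<epsilon> a' b c"
proof -
  let ?q = "\<lambda>a. energy_density \<alpha> \<beta> \<gamma> \<epsilon> a b c"
  have "?q (translate a t a') = (\<lambda>x. ?q a x + t * ?q a' x)"
    using mem
    by (elim gdual_cases)
       (simp add: energy_density_def translate_def circle_smooth_deriv_lin algebra_simps add_divide_distrib)
  moreover have "integral {0..2 * pi} (\<lambda>x. ?q a x + t * ?q a' x) =
      integral {0..2 * pi} (?q a) + integral {0..2 * pi} (\<lambda>x. t * ?q a' x)"
    by (intro Henstock_Kurzweil_Integration.integral_add integrable_on_mult_right
        circle_smooth_integrable energy_density_smooth mem)
  ultimately show ?thesis
    by (simp add: energy_form_def)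
qed

lemma uniform_limit_triple_product:
  fixes f g h :: "nat \<Rightarrow> real \<Rightarrow> real"
  assumes "uniform_limit UNIV f f' sequentially" "uniform_limit UNIV g g' sequentially"
    "uniform_limit UNIV h h' sequentially"
    and "f' \<in> circle_smooth" "g' \<in> circle_smooth" "h' \<in> circle_smooth"
  shows "uniform_limit UNIV (\<lambda>n x. f n x * g n x * h n x) (\<lambda>x. f' x * g' x * h' x) sequentially"
  using assms by (intro uniform_lim_mult circle_smooth_bounded circle_smooth_mult)

lemma energy_form_continuous:
  assumes "\<forall>n. as n \<in> gdual" "\<forall>n. bs n \<in> gdual" "\<forall>n. cs n \<in> gdual"
    and mem: "a \<in> gdual" "b \<in> gdual" "c \<in> gdual"
    and lim: "Cinf_tendsto as a" "Cinf_tendsto bs b" "Cinf_tendsto cs c"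
  shows "(\<lambda>n. energy_form \<alpha> \<beta> \<gamma> \<epsilon> (as n) (bs n) (cs n)) \<longlonglongrightarrow> energy_form \<alpha> \<beta> \<gamma> \<epsilon> a b c"
proof -
  have jets: "uniform_limit UNIV (\<lambda>n. fst (ws n)) (fst w) sequentially"
    "uniform_limit UNIV (\<lambda>n. deriv (fst (ws n))) (deriv (fst w)) sequentially"
    "uniform_limit UNIV (\<lambda>n. snd (ws n)) (snd w) sequentially"
    if "Cinf_tendsto ws w" for ws w
    using that[unfolded Cinf_tendsto_def, THEN spec, of 0] that[unfolded Cinf_tendsto_def, THEN spec, of 1]
    by simp_all
  have smooth: "fst w \<in> circle_smooth" "deriv (fst w) \<in> circle_smooth" "snd w \<in> circle_smooth"
    if "w \<in> gdual" for w
    using that by (simp_all add: gdual_fst gdual_snd circle_smooth_deriv)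
  have "uniform_limit UNIV (\<lambda>n. energy_density \<alpha> \<beta> \<gamma> \<epsilon> (as n) (bs n) (cs n))
      (energy_density \<alpha> \<beta> \<gamma> \<epsilon> a b c) sequentially"
    unfolding energy_density_def split_beta
    by (intro uniform_limit_add uniform_limit_cmult; rule uniform_limit_triple_product)
       (rule lim[THEN jets(1)] lim[THEN jets(2)] lim[THEN jets(3)]
          mem[THEN smooth(1)] mem[THEN smooth(2)] mem[THEN smooth(3)])+
  then have lim_int: "uniform_limit {0..2 * pi} (\<lambda>n. energy_density \<alpha> \<beta> \<gamma> \<epsilon> (as n) (bs n) (cs n))
      (energy_density \<alpha> \<beta> \<gamma> \<epsilon> a b c) sequentially"
    by (rule uniform_limit_on_subset) simp
  have cont: "continuous_on {0..2 * pi} (energy_density \<alpha> \<beta> \<gamma> \<epsilon> (as n) (bs n) (cs n))" for n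
    using assms by (intro circle_smooth_continuous_on energy_density_smooth) auto
  obtain I J where IJ:
    "\<And>n. (energy_density \<alpha> \<beta> \<gamma> \<epsilon> (as n) (bs n) (cs n) has_integral I n) {0..2 * pi}"
    "(energy_density \<alpha> \<beta> \<gamma> \<epsilon> a b c has_integral J) {0..2 * pi}" "I \<longlonglongrightarrow> J"
    by (rule uniform_limit_integral[OF lim_int cont trivial_limit_sequentially]) blast
  show ?thesis
    using IJ(3) by (simp add: energy_form_def integral_unique[OF IJ(1)] integral_unique[OF IJ(2)])
qed

text \<open>
  The variational derivative of the cubic energy with respect to \<open>w = (u, \<rho>)\<close>, and at the same time a
  primitive in \<open>x\<close> of the Euler field at \<open>M w\<close>.
\<close>

definition energy_gradient :: "real \<Rightarrow> real \<Rightarrow> real \<Rightarrow> real \<Rightarrow> fpair \<Rightarrow> fpair" where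
  "energy_gradient \<alpha> \<beta> \<gamma> \<epsilon> = (\<lambda>(u, \<rho>).
     ((\<lambda>x. 3 / 2 * \<epsilon> * (u x)\<^sup>2 - \<epsilon> * (u x * deriv (deriv u) x) - \<epsilon> / 2 * (deriv u x)\<^sup>2
           + 2 * \<alpha> * (u x * \<rho> x) - \<beta> * (u x * deriv \<rho> x) + \<gamma> / 2 * (\<rho> x)\<^sup>2),
      (\<lambda>x. \<alpha> * (u x)\<^sup>2 + \<beta> * (u x * deriv u x) + \<gamma> * (u x * \<rho> x))))"

lemma energy_gradient_gdual: "w \<in> gdual \<Longrightarrow> energy_gradient \<alpha> \<beta> \<gamma> \<epsilon> w \<in> gdual"
  by (elim gdual_cases) (auto simp: energy_gradient_def intro!: circle_smooth_intros)

text \<open>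
  The factor \<open>3\<close> comes from differentiating a cubic form. Two integrations by parts free \<open>f\<close>, the first component of
  \<open>v\<close>, from derivatives: they concern \<open>\<epsilon> u u' f'\<close> and \<open>\<beta> u \<rho> f'\<close>.
\<close>

lemma energy_form_gradient:
  assumes "v \<in> gdual" "w \<in> gdual"
  shows "3 * energy_form \<alpha> \<beta> \<gamma> \<epsilon> v w w = pairing (energy_gradient \<alpha> \<beta> \<gamma> \<epsilon> w) v"
proof -
  obtain f g u \<rho> where eqs: "v = (f, g)" "w = (u, \<rho>)"
    and smooth: "f \<in> circle_smooth" "g \<in> circle_smooth" "u \<in> circle_smooth" "\<rho> \<in> circle_smooth"
    using assms by (elim gdual_cases) blast
  note D = smooth[THEN circle_smooth_DERIV] smooth[THEN circle_smooth_deriv, THEN circle_smooth_DERIV]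
  let ?N = "energy_gradient \<alpha> \<beta> \<gamma> \<epsilon> w"
  have "3 * energy_form \<alpha> \<beta> \<gamma> \<epsilon> v w w = integral {0..2 * pi} (\<lambda>x. 3 * energy_density \<alpha> \<beta> \<gamma> \<epsilon> v w w x)"
    by (simp add: energy_form_def)
  also have "\<dots> = pairing ?N v"
    unfolding pairing_def
  proof (rule integral_eq_of_total_derivative)
    show "(\<lambda>x. 3 * energy_density \<alpha> \<beta> \<gamma> \<epsilon> v w w x) \<in> circle_smooth"
      by (intro circle_smooth_intros energy_density_smooth assms)
    show "(\<lambda>x. fst ?N x * fst v x + snd ?N x * snd v x) \<in> circle_smooth"
      by (intro circle_smooth_intros gdual_fst gdual_snd energy_gradient_gdual assms)
    show "(\<lambda>x. \<epsilon> * (u x * deriv u x * f x) + \<beta> * (u x * \<rho> x * f x)) \<in> circle_smooth"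
      by (intro circle_smooth_intros smooth)
    show "((\<lambda>x. \<epsilon> * (u x * deriv u x * f x) + \<beta> * (u x * \<rho> x * f x)) has_real_derivative
        3 * energy_density \<alpha> \<beta> \<gamma> \<epsilon> v w w x - (fst ?N x * fst v x + snd ?N x * snd v x)) (at x)" for x
      unfolding eqs energy_density_def energy_gradient_def prod.case fst_conv snd_conv
      by (rule D derivative_eq_intros refl)+ (simp add: algebra_simps power2_eq_square)
  qed
  finally show ?thesis .
qed

text \<open>
  For a special inertia operator the Euler field is a conservation law. This rests on
  \<open>m u' + p \<rho>'\<close> being the derivative of \<open>\<epsilon> (u\<^sup>2 - u'\<^sup>2) / 2 + \<alpha> u \<rho> + \<gamma> \<rho>\<^sup>2 / 2\<close>, because the terms in \<open>\<beta>\<close> cancel.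
\<close>

lemma lie_poisson_eq_deriv_energy_gradient:
  fixes \<alpha> \<beta> \<gamma> \<epsilon> :: real
  defines "M \<equiv> special_inertia_operator \<alpha> \<beta> \<gamma> \<epsilon>" and "N \<equiv> energy_gradient \<alpha> \<beta> \<gamma> \<epsilon>"
  assumes "w \<in> gdual"
  shows "lie_poisson (M w) w = (deriv (fst (N w)), deriv (snd (N w)))"
proof -
  obtain u \<rho> where eq: "w = (u, \<rho>)"
    and smooth: "u \<in> circle_smooth" "\<rho> \<in> circle_smooth"
    using assms by (elim gdual_cases) blast
  note D = smooth[THEN circle_smooth_DERIV] smooth[THEN circle_smooth_deriv, THEN circle_smooth_DERIV]
    smooth[THEN circle_smooth_deriv, THEN circle_smooth_deriv, THEN circle_smooth_DERIV]
  let ?m = "fst (M w)" and ?p = "snd (M w)"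
  note M' = deriv_special_inertia_operator[OF smooth, of \<alpha> \<beta> \<gamma> \<epsilon>, folded M_def eq]
  have "deriv (fst (N w)) x = deriv ?m x * u x + 2 * ?m x * deriv u x + ?p x * deriv \<rho> x" for x
    unfolding M' unfolding M_def N_def eq special_inertia_operator_def energy_gradient_def prod.case
      fst_conv snd_conv deriv_pow_2
    by (rule DERIV_imp_deriv, (rule D derivative_eq_intros refl)+)
       (simp add: algebra_simps power2_eq_square)
  moreover have "deriv (snd (N w)) x = deriv ?p x * u x + ?p x * deriv u x" for x
    unfolding M' unfolding M_def N_def eq special_inertia_operator_def energy_gradient_def prod.case
      fst_conv snd_conv
    by (rule DERIV_imp_deriv, (rule D derivative_eq_intros refl)+)
       (simp add: algebra_simps power2_eq_square)
  ultimately show ?thesis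
    by (auto simp: lie_poisson_def split_beta eq)
qed

text \<open>
  The modified structure attached to a special inertia operator is \<open>J = \<partial> M\<close>; matching the four entries dictates
  the constants.
\<close>

lemma modified_lie_poisson_eq_deriv_special:
  fixes \<alpha> \<beta> \<gamma> \<epsilon> :: real
  defines "M \<equiv> special_inertia_operator \<alpha> \<beta> \<gamma> \<epsilon>"
  assumes "w \<in> gdual"
  shows "modified_lie_poisson (\<epsilon> / 2) \<alpha> \<epsilon> (- \<beta>) (\<gamma> / 2) w = (deriv (fst (M w)), deriv (snd (M w)))"
  using assms(2)
  by (elim gdual_cases)
     (simp add: M_def deriv_special_inertia_operator,
      simp add: modified_lie_poisson_def special_inertia_operator_def deriv_pow_2 deriv_pow_3 algebra_simps)

text \<open>
  With \<open>N\<close> the energy gradient, \<open>H \<mu>\<close> is the cubic energy at \<open>w = inv M \<mu>\<close>. By symmetry of \<open>M\<close> its gradient is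
  \<open>inv M (N w)\<close>, and \<open>J = \<partial> M\<close> turns this into \<open>\<partial> (N w)\<close>, the Euler field.
\<close>

theorem special_imp_bihamiltonian:
  fixes \<alpha> \<beta> \<gamma> \<epsilon> :: real
  defines "M \<equiv> special_inertia_operator \<alpha> \<beta> \<gamma> \<epsilon>"
  assumes pos: "strictly_positive M" and bij: "bij_betw M gdual gdual"
  shows "\<exists>H. smooth_functional H \<and> L2_differentiable H \<and> (\<forall>\<mu>\<in>gdual.
    euler_field M \<mu> = modified_lie_poisson (\<epsilon> / 2) \<alpha> \<epsilon> (- \<beta>) (\<gamma> / 2) (L2_gradient H \<mu>))"
proof -
  have lin: "gdual_linear M"
    unfolding M_def special_inertia_operator_as_inertia_operator by (rule inertia_operator_linear)
  have sym: "pairing (M v) w = pairing v (M w)" if "v \<in> gdual" "w \<in> gdual" for v w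
    unfolding M_def special_inertia_operator_as_inertia_operator
    by (rule inertia_operator_symmetric[OF that])
  define K where "K = inv_into gdual M"
  have K_lin: "gdual_linear K"
    unfolding K_def by (rule gdual_linear_inv[OF lin bij])
  have K: "K \<mu> \<in> gdual" "M (K \<mu>) = \<mu>" if "\<mu> \<in> gdual" for \<mu>
    using gdual_linear_mem[OF K_lin that] bij_betw_inv_into_right[OF bij that] by (simp_all add: K_def)
  have K_cont: "Cinf_tendsto (\<lambda>n. K (\<mu>s n)) (K \<mu>)"
    if "\<forall>n. \<mu>s n \<in> gdual" "\<mu> \<in> gdual" "Cinf_tendsto \<mu>s \<mu>" for \<mu>s \<mu>
  proof (rule special_inverse_continuous[OF pos[unfolded M_def], folded M_def])
    show "Cinf_tendsto (\<lambda>n. M (K (\<mu>s n))) (M (K \<mu>))"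
      using that by (simp add: K)
  qed (use that K in simp_all)
  define T where "T a b c = energy_form \<alpha> \<beta> \<gamma> \<epsilon> (K a) (K b) (K c)" for a b c
  define H where "H \<mu> = T \<mu> \<mu> \<mu>" for \<mu>
  have T_sym: "T a b c = T b a c" "T a b c = T a c b" for a b c
    unfolding T_def by (rule energy_form_sym)+
  have T_lin: "T (translate a t a') b c = T a b c + t * T a' b c"
    if "a \<in> gdual" "a' \<in> gdual" "b \<in> gdual" "c \<in> gdual" for a a' b c t
    using that K by (simp add: T_def gdual_linear_translate[OF K_lin] energy_form_linear)
  have "smooth_functional (\<lambda>\<mu>. T \<mu> \<mu> \<mu>)"
    by (rule cubic_form_smooth[OF T_sym T_lin])
       (auto simp: T_def intro!: energy_form_continuous K K_cont)
  then have smooth: "smooth_functional H"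
    by (simp add: H_def[abs_def])
  define G where "G \<mu> = K (energy_gradient \<alpha> \<beta> \<gamma> \<epsilon> (K \<mu>))" for \<mu>
  have G: "G \<mu> \<in> gdual" "M (G \<mu>) = energy_gradient \<alpha> \<beta> \<gamma> \<epsilon> (K \<mu>)" if "\<mu> \<in> gdual" for \<mu>
    using that K by (simp_all add: G_def energy_gradient_gdual)
  have grad: "has_L2_gradient H \<mu> (G \<mu>)" if \<mu>: "\<mu> \<in> gdual" for \<mu>
    unfolding has_L2_gradient_def
  proof (intro conjI ballI)
    show "G \<mu> \<in> gdual" by (rule G[OF \<mu>])
    fix \<nu> assume \<nu>: "\<nu> \<in> gdual"
    have "3 * T \<nu> \<mu> \<mu> = pairing (M (G \<mu>)) (K \<nu>)"
      using \<mu> \<nu> K G by (simp add: T_def energy_form_gradient)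
    also have "\<dots> = pairing (G \<mu>) \<nu>"
      using sym[OF G(1)[OF \<mu>] K(1)[OF \<nu>]] K \<nu> by simp
    finally have "3 * T \<nu> \<mu> \<mu> = pairing (G \<mu>) \<nu>" .
    then show "((\<lambda>t. H (translate \<mu> t \<nu>)) has_real_derivative pairing (G \<mu>) \<nu>) (at 0)"
      using cubic_form_derivative[OF T_sym T_lin \<mu> \<nu>] by (simp add: H_def)
  qed
  have "euler_field M \<mu> = modified_lie_poisson (\<epsilon> / 2) \<alpha> \<epsilon> (- \<beta>) (\<gamma> / 2) (L2_gradient H \<mu>)"
    if \<mu>: "\<mu> \<in> gdual" for \<mu>
    using euler_field_eq[OF lin bij sym K(1)[OF \<mu>]]
      lie_poisson_eq_deriv_energy_gradient[OF K(1)[OF \<mu>], of \<alpha> \<beta> \<gamma> \<epsilon>]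
      modified_lie_poisson_eq_deriv_special[OF G(1)[OF \<mu>], of \<epsilon> \<alpha> \<beta> \<gamma>]
      L2_gradient_eqI[OF grad[OF \<mu>]] K[OF \<mu>] G[OF \<mu>]
    by (simp add: M_def)
  then show ?thesis
    using smooth grad unfolding L2_differentiable_def by blast
qed

section \<open>Characterization of the bi-Hamiltonian Euler fields\<close>

theorem theorem1:
  fixes n\<^sub>0 n\<^sub>1 :: nat and a b :: "nat \<Rightarrow> real" and \<gamma> \<epsilon> :: real
    and M :: "fpair \<Rightarrow> fpair"
  assumes "M = inertia_operator n\<^sub>0 n\<^sub>1 a b \<gamma> \<epsilon>"
    and "strictly_positive M"
    and "bij_betw M gdual gdual"
  shows "(\<exists>m\<^sub>0 p\<^sub>0 c\<^sub>1 c\<^sub>2 c\<^sub>3. \<exists>H\<^sub>1. smooth_functional H\<^sub>1 \<and> L2_differentiable H\<^sub>1 \<and>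
            (\<forall>\<mu>\<in>gdual. euler_field M \<mu> =
               modified_lie_poisson m\<^sub>0 p\<^sub>0 c\<^sub>1 c\<^sub>2 c\<^sub>3 (L2_gradient H\<^sub>1 \<mu>)))
         \<longleftrightarrow> (\<exists>\<alpha> \<beta> \<gamma>' \<epsilon>'. \<forall>w\<in>gdual. M w = special_inertia_operator \<alpha> \<beta> \<gamma>' \<epsilon>' w)"
proof
  assume "\<exists>m\<^sub>0 p\<^sub>0 c\<^sub>1 c\<^sub>2 c\<^sub>3. \<exists>H\<^sub>1. smooth_functional H\<^sub>1 \<and> L2_differentiable H\<^sub>1 \<and>
            (\<forall>\<mu>\<in>gdual. euler_field M \<mu> =
               modified_lie_poisson m\<^sub>0 p\<^sub>0 c\<^sub>1 c\<^sub>2 c\<^sub>3 (L2_gradient H\<^sub>1 \<mu>))"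
  then show "\<exists>\<alpha> \<beta> \<gamma>' \<epsilon>'. \<forall>w\<in>gdual. M w = special_inertia_operator \<alpha> \<beta> \<gamma>' \<epsilon>' w"
    using bihamiltonian_imp_special assms by meson
next
  assume "\<exists>\<alpha> \<beta> \<gamma>' \<epsilon>'. \<forall>w\<in>gdual. M w = special_inertia_operator \<alpha> \<beta> \<gamma>' \<epsilon>' w"
  then obtain \<alpha> \<beta> \<gamma>' \<epsilon>' where M: "\<And>w. w \<in> gdual \<Longrightarrow> M w = special_inertia_operator \<alpha> \<beta> \<gamma>' \<epsilon>' w"
    by blast
  let ?S = "special_inertia_operator \<alpha> \<beta> \<gamma>' \<epsilon>'"
  have "strictly_positive ?S"
    using assms(2) M by (simp add: strictly_positive_def)
  moreover have "bij_betw ?S gdual gdual"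
    using assms(3) M by (simp add: bij_betw_cong[of gdual M ?S])
  moreover have "inv_into gdual M = inv_into gdual ?S"
    using M by (simp add: inv_into_def fun_eq_iff cong: conj_cong)
  then have "kinetic_energy M = kinetic_energy ?S"
    by (intro ext) (simp only: kinetic_energy_def)
  then have "euler_field M = euler_field ?S"
    by (intro ext) (simp only: euler_field_def)
  ultimately show "\<exists>m\<^sub>0 p\<^sub>0 c\<^sub>1 c\<^sub>2 c\<^sub>3. \<exists>H\<^sub>1. smooth_functional H\<^sub>1 \<and> L2_differentiable H\<^sub>1 \<and>
            (\<forall>\<mu>\<in>gdual. euler_field M \<mu> =
               modified_lie_poisson m\<^sub>0 p\<^sub>0 c\<^sub>1 c\<^sub>2 c\<^sub>3 (L2_gradient H\<^sub>1 \<mu>))"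
    using special_imp_bihamiltonian by metis
qed

end
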